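(* Let $f,g\in\mathbb{R}[x,y]$ be nonzero polynomials with $f(0,0)=g(0,0)=0$, and let $F_{f,g}:=\frac{\partial f}{\partial x}\frac{\partial g}{\partial y}-\frac{\partial f}{\partial y}\frac{\partial g}{\partial x}$. Assume that $g$ has an isolated zero at the origin, that $F_{f,g}\not\equiv 0$, and that the polynomials $f$, $g$ and $F_{f,g}$ are $y$-regular. Then the following conditions are equivalent: (i) $\displaystyle\lim_{(x,y)\to(0,0)}\frac{f(x,y)}{g(x,y)}=0$. (ii) For each sign $*\in\{+,-\}$ and every $\gamma\in\mathbf{P}^{*}(F_{f,g})\setminus\mathbf{P}^{*}(f)$, we have $$\operatorname{ord} f( *x,\gamma(x))>\operatorname{ord} g( *x,\gamma(x)).$$
   Context: Order and $y$-regularity: for a nonzero polynomial $h=h_m+h_{m+1}+\cdots$ (homogeneous components, $h_m\not\equiv0$ of lowest degree $m$), $\operatorname{ord} h:=m$; $h$ is $y$-regular (of order $m$) if $h_m(0,1)\neq0$. Puiseux series: a Puiseux series is either $\varphi\equiv 0$ or $\varphi(x)=c_1x^{n_1/n}+c_2x^{n_2/n}+\cdots$ with $c_k\in\mathbb{C}$ and positive integers $n\le n_1<n_2<\cdots$ having no common divisor, such that the power series $\varphi(t^n)$ has positive radius of convergence. It is real if all $c_k$ are real. The order $\operatorname{ord}$ of a series in fractional powers of $x$ is its smallest exponent with nonzero coefficient, and $+\infty$ for the zero series. $\varphi$ is a Newton–Puiseux root of $h$ if $h(x,\varphi(x))\equiv0$; $\mathbf{P}(h)$ is the set of Newton–Puiseux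 roots of $h$. For $h\in\mathbb{R}[x,y]$, $\mathbf{P}^{+}(h):=\{\varphi\in\mathbf{P}(h):\varphi\text{ is real}\}$ and $\mathbf{P}^{-}(h):=\mathbf{P}^{+}(h(-x,y))$. The notation $*x$ means $x$ if $*=+$ and $-x$ if $*=-$. "$g$ has an isolated zero at the origin" means $g(0,0)=0$ and $g\neq0$ at all other real points in some neighborhood of $(0,0)$ in $\mathbb{R}^2$. The limit is taken over points of $\mathbb{R}^2$ where $g\ne0$. *)

theory Defs
  imports
    "HOL-Analysis.Analysis"
    "HOL-Computational_Algebra.Polynomial_FPS"
begin

text \<open>
  A polynomial in $R[x,y]$ is an element of \<^typ>\<open>real poly poly\<close>: the outer variable is $y$ and
  the coefficients are polynomials in $x$, so the coefficient of $x^i y^j$ in \<open>h\<close> is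
  \<open>coeff (coeff h j) i\<close>.
\<close>

definition poly2 :: "real poly poly \<Rightarrow> real \<Rightarrow> real \<Rightarrow> real" where
  "poly2 h a b = poly (poly h [:b:]) a"

definition pderiv_x :: "real poly poly \<Rightarrow> real poly poly" where
  "pderiv_x h = map_poly pderiv h"

definition pderiv_y :: "real poly poly \<Rightarrow> real poly poly" where
  "pderiv_y h = pderiv h"

definition jacobian2 :: "real poly poly \<Rightarrow> real poly poly \<Rightarrow> real poly poly" where
  "jacobian2 f g = pderiv_x f * pderiv_y g - pderiv_y f * pderiv_x g"

definition hom_component :: "real poly poly \<Rightarrow> nat \<Rightarrow> real poly poly" where
  "hom_component h m = (\<Sum>j\<le>m. monom (monom (coeff (coeff h j) (m - j)) (m - j)) j)"

text \<open>The order; only meaningful for \<open>h \<noteq> 0\<close>.\<close>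

definition ord2 :: "real poly poly \<Rightarrow> nat" where
  "ord2 h = (LEAST m. hom_component h m \<noteq> 0)"

definition y_regular :: "real poly poly \<Rightarrow> bool" where
  "y_regular h \<longleftrightarrow> h \<noteq> 0 \<and> poly2 (hom_component h (ord2 h)) 0 1 \<noteq> 0"

definition isolated_zero_at_origin :: "real poly poly \<Rightarrow> bool" where
  "isolated_zero_at_origin h \<longleftrightarrow>
     poly2 h 0 0 = 0 \<and> (\<forall>\<^sub>F (a, b) in at (0, 0). poly2 h a b \<noteq> 0)"

text \<open>
  A pair \<open>(n, p)\<close> stands for the series $\varphi(x) = p(x^{1/n})$, that is,
  $p(t) = \varphi(t^n)$. The exponents of the nonzero coefficients of $p$ are the numerators
  $n_1 < n_2 < \cdots$ (finitely or infinitely many). The condition on the greatest common divisor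
  makes the representation unique, so equality of pairs is equality of series; it forces the
  zero series to be \<open>(1, 0)\<close>.
\<close>

definition puiseux_series :: "(nat \<times> complex fps) set" where
  "puiseux_series = {(n, p). n > 0 \<and> (\<forall>k. fps_nth p k \<noteq> 0 \<longrightarrow> n \<le> k) \<and>
      Gcd (insert n {k. fps_nth p k \<noteq> 0}) = 1 \<and> fps_conv_radius p > 0}"

definition real_puiseux :: "nat \<times> complex fps \<Rightarrow> bool" where
  "real_puiseux \<phi> \<longleftrightarrow> (\<forall>k. fps_nth (snd \<phi>) k \<in> \<real>)"

text \<open>The power series $h(t^n, \varphi(t^n))$ in $t$, which is $h(x, \varphi(x))$ with $x = t^n$.\<close>

definition puiseux_subst :: "real poly poly \<Rightarrow> nat \<times> complex fps \<Rightarrow> complex fps" where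
  "puiseux_subst h \<phi> =
     poly (map_poly (\<lambda>q. poly (map_poly (\<lambda>c. fps_const (complex_of_real c)) q)
                              (fps_X ^ fst \<phi>)) h) (snd \<phi>)"

text \<open>The order of $h(x, \varphi(x))$ with respect to $x$, hence the division by \<open>n\<close>.\<close>

definition ord_subst :: "real poly poly \<Rightarrow> nat \<times> complex fps \<Rightarrow> ereal" where
  "ord_subst h \<phi> =
     (if puiseux_subst h \<phi> = 0 then \<infinity>
      else ereal (real (subdegree (puiseux_subst h \<phi>)) / real (fst \<phi>)))"

definition newton_puiseux_roots :: "real poly poly \<Rightarrow> (nat \<times> complex fps) set" where
  "newton_puiseux_roots h = {\<phi> \<in> puiseux_series. puiseux_subst h \<phi> = 0}"

text \<open>The polynomial $h(sx, y)$.\<close>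

definition scale_x :: "real \<Rightarrow> real poly poly \<Rightarrow> real poly poly" where
  "scale_x s h = map_poly (\<lambda>q. pcompose q [:0, s:]) h"

text \<open>$\mathbf{P}^{+}(h)$ for \<open>s = 1\<close> and $\mathbf{P}^{-}(h)$ for \<open>s = -1\<close>.\<close>

definition real_newton_puiseux_roots ::
    "real \<Rightarrow> real poly poly \<Rightarrow> (nat \<times> complex fps) set" where
  "real_newton_puiseux_roots s h = {\<phi> \<in> newton_puiseux_roots (scale_x s h). real_puiseux \<phi>}"

end

(*
  Restricted to a real branch y = p(t), x = s t^n of F = 0, both f and g are convergent power
  series in t, so (i) gives the strict inequality of orders. Conversely, suppose |f| >= eps |g| > 0
  at points arbitrarily close to the origin. Maximising |f| on the compact level sets of g moves
  these points to points of F = 0 (Lagrange multipliers) that still tend to the origin, because g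
  has an isolated zero. As F is y-regular, |y| <= C |x| along them, and it remains to see that
  infinitely many of them lie on one real Puiseux branch, along which f/g tends to 0 by (ii).

  The branch comes from monodromy instead of the Newton polygon. Let G be of least y-degree among
  the polynomials vanishing at infinitely many of the points; then the ideal (G, G_y) contains a
  nonzero polynomial in x alone, so over a punctured disc the curve G = 0 is a finite covering.
  Lifting exp from a half plane gives finitely many holomorphic branches Y(w) with x = exp w, each
  of a period 2 pi i N, hence holomorphic in t = x^(1/N); growth along the points excludes a pole.
*)
theory Submission
  imports Defs "HOL-Complex_Analysis.Complex_Analysis"
    "HOL-Computational_Algebra.Fundamental_Theorem_Algebra"
begin

text \<open>On a level set of g the bound |f| >= eps |g| survives any increase of |f|; this is why
  the points are moved inside level sets of g. What is known afterwards is known only at points, and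
  one principle carries it to power series: a function with a nonzero expansion at 0 vanishes at
  only finitely many members of a sequence of nonzero points tending to 0. Hence agreement at
  infinitely many points is enough. It makes the branch a root of F although it is built from G,
  makes its coefficients real although it is built over the complex numbers, and shows that f and g
  do not vanish identically on it. No branch has to be classified: the pigeonhole principle lets the
  points select one, so all statements speak of infinitely many indices, never of all. Choosing G
  and a generator of its ideal by least degree replaces irreducible factors, Gauss's lemma and
  resultants. The bound |y| <= C |x| has a further task: in t it reads |p(t)| <= C |t|^N, so all
  exponents in x are at least 1, as \<open>puiseux_series\<close> demands.\<close>

section \<open>Polynomials in two variables\<close>

text \<open>\<open>poly2\<close> is tied to real coefficients; the ring is left open here so that
  the same rules serve real polynomials and their complexifications.\<close>

definition eval2 :: "'a::comm_ring_1 poly poly \<Rightarrow> 'a \<Rightarrow> 'a \<Rightarrow> 'a" where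
  "eval2 G x y = poly (poly G [:y:]) x"

definition fiber_poly :: "'a::comm_ring_1 poly poly \<Rightarrow> 'a \<Rightarrow> 'a poly" where
  "fiber_poly G x = map_poly (\<lambda>q. poly q x) G"

lemma eval2_add: "eval2 (G + H) x y = eval2 G x y + eval2 H x y"
  and eval2_mult: "eval2 (G * H) x y = eval2 G x y * eval2 H x y"
  and eval2_smult: "eval2 (smult c G) x y = poly c x * eval2 G x y"
  and eval2_const: "eval2 [:c:] x y = poly c x"
  and eval2_0: "eval2 0 x y = 0"
  by (simp_all add: eval2_def)

lemma eval2_pCons: "eval2 (pCons a G) x y = poly a x + y * eval2 G x y"
  by (simp add: eval2_def)

lemma poly_fiber_poly: "poly (fiber_poly G x) y = eval2 G x y"
proof (induction G)
  case 0
  show ?case by (simp add: eval2_def fiber_poly_def)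
next
  case (pCons a G)
  then have "fiber_poly (pCons a G) x = pCons (poly a x) (fiber_poly G x)"
    by (auto simp: fiber_poly_def map_poly_pCons)
  then show ?case using pCons by (simp add: eval2_pCons)
qed

lemma coeff_fiber_poly: "coeff (fiber_poly G x) j = poly (coeff G j) x"
  by (simp add: fiber_poly_def coeff_map_poly)

lemma pderiv_fiber_poly:
  fixes G :: "complex poly poly"
  shows "pderiv (fiber_poly G x) = fiber_poly (pderiv G) x"
  by (intro poly_eqI) (simp add: coeff_pderiv coeff_fiber_poly)

lemma degree_fiber_poly:
  assumes "poly (lead_coeff G) x \<noteq> 0"
  shows "degree (fiber_poly G x) = degree G"
proof (rule antisym)
  show "degree (fiber_poly G x) \<le> degree G"
    by (rule degree_le) (simp add: coeff_fiber_poly coeff_eq_0)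
  show "degree G \<le> degree (fiber_poly G x)"
    by (rule le_degree) (simp add: coeff_fiber_poly assms)
qed

lemma eval2_eq_sum:
  "eval2 G x y = (\<Sum>j\<le>degree G. poly (coeff G j) x * y ^ j)"
proof -
  have "eval2 G x y = poly (fiber_poly G x) y" by (simp add: poly_fiber_poly)
  also have "\<dots> = (\<Sum>j\<le>degree (fiber_poly G x). poly (coeff G j) x * y ^ j)"
    by (simp add: poly_altdef coeff_fiber_poly)
  also have "\<dots> = (\<Sum>j\<le>degree G. poly (coeff G j) x * y ^ j)"
  proof (rule sum.mono_neutral_left)
    have "degree (fiber_poly G x) \<le> degree G"
      by (rule degree_le) (simp add: coeff_fiber_poly coeff_eq_0)
    then show "{..degree (fiber_poly G x)} \<subseteq> {..degree G}" by simp
    show "\<forall>j\<in>{..degree G} - {..degree (fiber_poly G x)}. poly (coeff G j) x * y ^ j = 0"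
      by (auto simp: coeff_eq_0 simp flip: coeff_fiber_poly)
  qed simp
  finally show ?thesis .
qed

text \<open>G of least degree behaves like a prime element: if a multiple of G by a nonzero
  polynomial in x splits, one factor inherits infinitely many of the points. Let E have least degree
  in the ideal of G and its derivative. Up to nonzero factors in x, E divides both. If E had
  positive degree, the splitting of G would force deg E >= deg G, too large for a divisor of the
  derivative. The hypothesis \<open>fin\<close> excludes that G is a polynomial in x alone.\<close>

lemma exists_separable_factor:
  fixes F :: "complex poly poly" and X Y :: "nat \<Rightarrow> complex"
  assumes F: "F \<noteq> 0" "\<And>k. eval2 F (X k) (Y k) = 0"
    and fin: "\<And>q. q \<noteq> 0 \<Longrightarrow> finite {k. poly q (X k) = 0}"
  obtains G A B d where "infinite {k. eval2 G (X k) (Y k) = 0}" "degree G > 0"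
    "d \<noteq> 0" "A * G + B * pderiv G = [:d:]"
proof -
  define P where "P G \<longleftrightarrow> G \<noteq> 0 \<and> infinite {k. eval2 G (X k) (Y k) = 0}" for G
  have "P F" using F by (simp add: P_def)
  define G where "G = arg_min degree P"
  have G: "P G" and Gmin: "\<And>H. P H \<Longrightarrow> degree G \<le> degree H"
    unfolding G_def using arg_min_nat_lemma[of P F degree] \<open>P F\<close> by auto
  have Pfac: "P H \<or> P K" if "smult a G = H * K" "a \<noteq> 0" for a H K
  proof -
    have "H \<noteq> 0" "K \<noteq> 0" using that G by (auto simp: P_def)
    have "{k. eval2 G (X k) (Y k) = 0} \<subseteq> {k. eval2 H (X k) (Y k) = 0} \<union> {k. eval2 K (X k) (Y k) = 0}"
    proof
      fix k assume "k \<in> {k. eval2 G (X k) (Y k) = 0}"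
      then have "eval2 (H * K) (X k) (Y k) = 0"
        by (simp flip: that(1) add: eval2_smult)
      then show "k \<in> {k. eval2 H (X k) (Y k) = 0} \<union> {k. eval2 K (X k) (Y k) = 0}"
        by (auto simp: eval2_mult)
    qed
    then have "infinite {k. eval2 H (X k) (Y k) = 0} \<or> infinite {k. eval2 K (X k) (Y k) = 0}"
      using G unfolding P_def by (meson finite_UnI finite_subset)
    then show ?thesis using \<open>H \<noteq> 0\<close> \<open>K \<noteq> 0\<close> by (auto simp: P_def)
  qed
  have degG: "degree G > 0"
  proof (rule ccontr)
    assume "\<not> degree G > 0"
    then obtain c where c: "G = [:c:]" by (metis degree_eq_zeroE gr0I)
    then show False using G fin[of c] by (auto simp: P_def eval2_const)
  qed
  define J where "J E \<longleftrightarrow> E \<noteq> 0 \<and> (\<exists>A B. E = A * G + B * pderiv G)" for E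
  have "J G" unfolding J_def using G by (intro conjI exI[of _ 1] exI[of _ 0]) (auto simp: P_def)
  define E where "E = arg_min degree J"
  have E: "J E" and Emin: "\<And>H. J H \<Longrightarrow> degree E \<le> degree H"
    unfolding E_def using arg_min_nat_lemma[of J G degree] \<open>J G\<close> by auto
  obtain A B where AB: "E = A * G + B * pderiv G" and E0: "E \<noteq> 0" using E by (auto simp: J_def)
  \<comment> \<open>Pseudo-division stays within polynomials in x; the remainder again lies in the
    ideal and has smaller degree than E, so it is zero.\<close>
  have div: "\<exists>a q. a \<noteq> 0 \<and> smult a H = E * q" if H: "H = C * G + D * pderiv G" for H C D
  proof -
    obtain a q where aq: "a \<noteq> 0" "smult a H = E * q + pseudo_mod H E"
      using pseudo_mod(1)[OF E0, of H] by blast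
    have "pseudo_mod H E = smult a H - E * q" using aq by simp
    also have "\<dots> = (smult a C - q * A) * G + (smult a D - q * B) * pderiv G"
      unfolding H AB by (simp add: algebra_simps smult_add_right)
    finally have "pseudo_mod H E = 0"
      using pseudo_mod(2)[OF E0, of H] Emin[of "pseudo_mod H E"] unfolding J_def by fastforce
    then show ?thesis using aq by auto
  qed
  have degE: "degree E = 0"
  proof (rule ccontr)
    assume E1: "degree E \<noteq> 0"
    obtain a q where aq: "a \<noteq> 0" "smult a G = E * q" using div[of G 1 0] by auto
    have q0: "q \<noteq> 0" using aq G by (auto simp: P_def)
    have "degree G = degree E + degree q"
      using aq(1) arg_cong[OF aq(2), of degree] E0 q0 by (simp add: degree_mult_eq)
    \<comment> \<open>The alternative \<open>P q\<close> would give deg G <= deg q, but deg E > 0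
      makes deg q < deg G.\<close>
    then have "degree G \<le> degree E" using Pfac[OF aq(2,1)] Gmin E1 by fastforce
    obtain b r where br: "b \<noteq> 0" "smult b (pderiv G) = E * r" using div[of "pderiv G" 0 1] by auto
    have "pderiv G \<noteq> 0" using degG by (simp add: pderiv_eq_0_iff)
    then have "r \<noteq> 0" using br by auto
    then have "degree (pderiv G) = degree E + degree r"
      using br(1) arg_cong[OF br(2), of degree] E0 by (simp add: degree_mult_eq)
    then show False using \<open>degree G \<le> degree E\<close> degG by (simp add: degree_pderiv)
  qed
  then obtain d where d: "E = [:d:]" by (metis degree_eq_zeroE)
  show ?thesis
    by (rule that[of G d A B]) (use G degG d E0 AB in \<open>auto simp: P_def\<close>)
qed

section \<open>The covering of a punctured disc by a separable curve\<close>

text \<open>The value at z is the leading coefficient times the product of the distances to the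
  roots; if all of these were at least e, the value could not be that small. This is continuity of
  roots in quantitative form.\<close>

lemma root_near_small_value:
  fixes p :: "complex poly"
  assumes "p \<noteq> 0" "e \<ge> 0" "norm (poly p z) < norm (lead_coeff p) * e ^ degree p"
  obtains y where "poly p y = 0" "dist y z < e"
proof -
  have *: "e ^ size M \<le> norm (\<Prod>x\<in>#M. z - x)" if "\<And>x. x \<in># M \<Longrightarrow> e \<le> norm (z - x)" for M
    using that
  proof (induction M)
    case (add a M)
    then have "e * e ^ size M \<le> norm (z - a) * norm (\<Prod>x\<in>#M. z - x)"
      by (intro mult_mono) (auto simp: assms)
    then show ?case by (simp add: norm_mult)
  qed simp
  have "\<exists>x. poly p x = 0 \<and> norm (z - x) < e"
  proof (rule ccontr)
    assume "\<not> ?thesis"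
    then have "e ^ degree p \<le> norm (\<Prod>x\<in>#proots p. z - x)"
      using *[of "proots p"] assms(1) by (force simp: size_proots_complex)
    then have "norm (lead_coeff p) * e ^ degree p \<le> norm (lead_coeff p) * norm (\<Prod>x\<in>#proots p. z - x)"
      by (intro mult_left_mono) auto
    also have "\<dots> = norm (poly (smult (lead_coeff p) (\<Prod>x\<in>#proots p. [:-x, 1:])) z)"
      by (simp add: norm_mult poly_prod_mset image_mset.compositionality o_def)
    also have "\<dots> = norm (poly p z)" by (simp only: complex_poly_decompose_multiset)
    finally show False using assms by simp
  qed
  then show ?thesis using that by (metis dist_commute dist_norm)
qed

lemma continuous_eval2 [continuous_intros]:
  fixes G :: "complex poly poly"
  assumes "continuous F a" "continuous F b"
  shows "continuous F (\<lambda>t. eval2 G (a t) (b t))"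
  unfolding eval2_eq_sum by (intro continuous_intros assms)

text \<open>The two nonvanishing conditions exclude ramification over the punctured disc: no root
  escapes to infinity and no two roots collide.\<close>

locale separable_curve =
  fixes G :: "complex poly poly" and \<delta> :: real
  assumes delta_pos: "\<delta> > 0"
    and degree_pos: "degree G > 0"
    and lead_coeff_nz: "\<And>x. x \<noteq> 0 \<Longrightarrow> norm x < \<delta> \<Longrightarrow> poly (lead_coeff G) x \<noteq> 0"
    and simple_roots: "\<And>x y. x \<noteq> 0 \<Longrightarrow> norm x < \<delta> \<Longrightarrow> eval2 G x y = 0 \<Longrightarrow> eval2 (pderiv G) x y \<noteq> 0"
begin

definition base :: "complex set" where
  "base = ball 0 \<delta> - {0}"

definition curve :: "(complex \<times> complex) set" where
  "curve = {(x, y). x \<in> base \<and> eval2 G x y = 0}"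

definition roots_at :: "complex \<Rightarrow> complex set" where
  "roots_at x = {y. eval2 G x y = 0}"

lemma open_base: "open base" by (auto simp: base_def intro!: open_delete)

lemma fiber_nz: "x \<in> base \<Longrightarrow> fiber_poly G x \<noteq> 0"
  using lead_coeff_nz[of x] by (metis (no_types) base_def coeff_0 coeff_fiber_poly Diff_iff
      dist_norm insertI1 mem_ball norm_minus_cancel diff_0)

lemma card_roots_at: "x \<in> base \<Longrightarrow> card (roots_at x) = degree G"
proof -
  assume x: "x \<in> base"
  then have x': "x \<noteq> 0" "norm x < \<delta>" by (auto simp: base_def)
  have "rsquarefree (fiber_poly G x)"
    unfolding rsquarefree_roots pderiv_fiber_poly poly_fiber_poly
    using simple_roots[OF x'] by blast
  then have "degree (fiber_poly G x) =
      degree (smult (lead_coeff (fiber_poly G x)) (\<Prod>z | poly (fiber_poly G x) z = 0. [:-z, 1:]))"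
    by (simp only: complex_poly_decompose_rsquarefree)
  also have "\<dots> = card {y. poly (fiber_poly G x) y = 0}"
    using fiber_nz[OF x] by (simp add: degree_prod_sum_eq)
  finally have "card {y. poly (fiber_poly G x) y = 0} = degree (fiber_poly G x)" ..
  then show ?thesis
    by (simp add: poly_fiber_poly roots_at_def degree_fiber_poly lead_coeff_nz x')
qed

lemma finite_roots_at: "x \<in> base \<Longrightarrow> finite (roots_at x)"
  using card_roots_at[of x] degree_pos card.infinite by fastforce

text \<open>With y kept fixed, G(x', y) tends to 0 as x' tends to x, while the leading coefficient
  stays away from 0; so the value at y becomes small enough to force a root nearby.\<close>

lemma eventually_root_near:
  assumes "x \<in> base" "eval2 G x y = 0" "e > 0"
  shows "\<forall>\<^sub>F x' in nhds x. \<exists>y'. eval2 G x' y' = 0 \<and> dist y' y < e"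
proof -
  define h where "h x' = norm (poly (lead_coeff G) x') * e ^ degree G - norm (eval2 G x' y)" for x'
  have "isCont h x" unfolding h_def by (intro continuous_intros)
  moreover have "h x > 0"
    using assms lead_coeff_nz[of x] by (auto simp: h_def base_def)
  ultimately have "\<forall>\<^sub>F x' in nhds x. h x' > 0"
    by (metis continuous_within order_tendstoD(1) tendsto_at_iff_tendsto_nhds)
  moreover have "\<forall>\<^sub>F x' in nhds x. x' \<in> base"
    using assms open_base eventually_nhds by blast
  ultimately show ?thesis
  proof eventually_elim
    case (elim x')
    then have nz: "poly (lead_coeff G) x' \<noteq> 0" using lead_coeff_nz[of x'] by (auto simp: base_def)
    have "norm (poly (fiber_poly G x') y) < norm (lead_coeff (fiber_poly G x')) * e ^ degree (fiber_poly G x')"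
      using elim(1) by (simp add: h_def poly_fiber_poly degree_fiber_poly[OF nz] coeff_fiber_poly)
    then obtain y' where "poly (fiber_poly G x') y' = 0" "dist y' y < e"
      using root_near_small_value[OF fiber_nz[OF elim(2)]] assms(3) by (metis less_imp_le)
    then show ?case by (auto simp: poly_fiber_poly)
  qed
qed

text \<open>Small disjoint balls around the roots over x0 each keep at least one root for x near x0.
  All fibres have the same number of points, so each ball keeps exactly one, and these roots form
  the continuous sections that trivialise the curve over T.\<close>

lemma covering_space_curve: "covering_space curve fst base"
  unfolding covering_space_def
proof (intro conjI ballI)
  show "continuous_on curve fst" by (intro continuous_intros)
  have "\<exists>y. eval2 G x y = 0" if "x \<in> base" for x
    using card_roots_at[OF that] degree_pos card_gt_0_iff[of "roots_at x"] by (auto simp: roots_at_def)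
  then show "fst ` curve = base" by (force simp: curve_def image_iff)
next
  fix x0 assume x0: "x0 \<in> base"
  define Z where "Z = roots_at x0"
  have finZ: "finite Z" using finite_roots_at x0 Z_def by auto
  have "\<exists>e>0. \<forall>z\<in>Z. \<forall>z'\<in>Z. z \<noteq> z' \<longrightarrow> 2 * e \<le> dist z z'"
  proof -
    define D where "D = (\<lambda>(z, z'). dist z z') ` {(z, z') \<in> Z \<times> Z. z \<noteq> z'}"
    have "finite D" unfolding D_def
      by (intro finite_imageI finite_subset[OF _ finite_cartesian_product[OF finZ finZ]]) auto
    \<comment> \<open>The element 1 keeps \<open>Min\<close> meaningful when the fibre is a single
      point and D is empty.\<close>
    then have "Min (insert 1 D) > 0" by (auto simp: D_def)
    moreover have "Min (insert 1 D) \<le> dist z z'" if "z \<in> Z" "z' \<in> Z" "z \<noteq> z'" for z z'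
      using \<open>finite D\<close> that by (intro Min_le) (auto simp: D_def image_iff)
    ultimately show ?thesis by (intro exI[of _ "Min (insert 1 D) / 2"]) auto
  qed
  then obtain e where e: "e > 0" "\<And>z z'. z \<in> Z \<Longrightarrow> z' \<in> Z \<Longrightarrow> z \<noteq> z' \<Longrightarrow> 2 * e \<le> dist z z'"
    by blast
  have sep: "z = z'" if "z \<in> Z" "z' \<in> Z" "y \<in> ball z e" "y \<in> ball z' e" for z z' y
  proof (rule ccontr)
    assume "z \<noteq> z'"
    then have "2 * e \<le> dist z y + dist y z'" using e(2)[OF that(1,2)] dist_triangle[of z z' y] by simp
    then show False using that by (simp add: dist_commute)
  qed
  have "\<forall>\<^sub>F x in nhds x0. \<forall>z\<in>Z. \<exists>y. eval2 G x y = 0 \<and> dist y z < e"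
    by (rule eventually_ball_finite[OF finZ])
       (use eventually_root_near[OF x0 _ e(1)] in \<open>auto simp: Z_def roots_at_def\<close>)
  moreover have "\<forall>\<^sub>F x in nhds x0. x \<in> base"
    using x0 open_base eventually_nhds by blast
  ultimately have "\<forall>\<^sub>F x in nhds x0. x \<in> base \<and> (\<forall>z\<in>Z. \<exists>y. eval2 G x y = 0 \<and> dist y z < e)"
    by eventually_elim auto
  then obtain T where T: "open T" "x0 \<in> T" "T \<subseteq> base"
    and near: "\<And>x z. x \<in> T \<Longrightarrow> z \<in> Z \<Longrightarrow> \<exists>y. eval2 G x y = 0 \<and> dist y z < e"
    unfolding eventually_nhds by blast
  obtain s where s: "\<And>x z. x \<in> T \<Longrightarrow> z \<in> Z \<Longrightarrow> eval2 G x (s x z) = 0 \<and> s x z \<in> ball z e"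
    using near by (metis mem_ball dist_commute)
  \<comment> \<open>The counting step: s x is injective because the balls are disjoint, and both
    fibres have \<open>degree G\<close> points.\<close>
  have s_surj: "s x ` Z = roots_at x" if x: "x \<in> T" for x
  proof (rule card_subset_eq)
    show "finite (roots_at x)" using finite_roots_at T x by auto
    show "s x ` Z \<subseteq> roots_at x" using s x by (auto simp: roots_at_def)
    have "inj_on (s x) Z" using s[OF x] sep by (metis inj_onI)
    then show "card (s x ` Z) = card (roots_at x)"
      using card_roots_at x0 x T by (auto simp: card_image Z_def)
  qed
  have s_unique: "y = s x z" if xz: "x \<in> T" "z \<in> Z" "eval2 G x y = 0" "y \<in> ball z e" for x y z
  proof -
    have "y \<in> s x ` Z" using s_surj[OF xz(1)] xz(3) by (simp add: roots_at_def)
    then obtain z' where "z' \<in> Z" "y = s x z'" by blast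
    then show ?thesis using sep xz s by blast
  qed
  have s_cont: "continuous_on T (\<lambda>x. s x z)" if z: "z \<in> Z" for z
  proof (rule continuous_at_imp_continuous_on, rule ballI)
    fix x assume x: "x \<in> T"
    show "isCont (\<lambda>x. s x z) x"
      unfolding isCont_def
    proof (rule tendstoI)
      fix e' :: real assume "e' > 0"
      \<comment> \<open>Besides e', the radius is limited so that the root found near
        \<open>s x z\<close> still lies in the ball around z, where it can only be
        \<open>s x' z\<close>.\<close>
      define \<epsilon> where "\<epsilon> = min e' (e - dist z (s x z))"
      have "\<epsilon> > 0" using \<open>e' > 0\<close> s[OF x z] by (simp add: \<epsilon>_def)
      have "x \<in> base" using x T by auto
      have "\<forall>\<^sub>F x' in nhds x. \<exists>y. eval2 G x' y = 0 \<and> dist y (s x z) < \<epsilon>"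
        by (rule eventually_root_near) (use s[OF x z] \<open>\<epsilon> > 0\<close> \<open>x \<in> base\<close> in auto)
      moreover have "\<forall>\<^sub>F x' in nhds x. x' \<in> T" using T x eventually_nhds by blast
      ultimately have "\<forall>\<^sub>F x' in nhds x. dist (s x' z) (s x z) < e'"
      proof eventually_elim
        case (elim x')
        then obtain y where y: "eval2 G x' y = 0" "dist y (s x z) < \<epsilon>" by blast
        have "dist z y \<le> dist z (s x z) + dist y (s x z)" by (rule dist_triangle2)
        then have "y \<in> ball z e" using y(2) by (simp add: \<epsilon>_def)
        then have "y = s x' z" using s_unique elim z y by blast
        then show ?case using y by (simp add: \<epsilon>_def)
      qed
      then show "\<forall>\<^sub>F x' in at x. dist (s x' z) (s x z) < e'" by (simp add: eventually_nhds_conv_at)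
    qed
  qed
  define u where "u z = curve \<inter> (T \<times> ball z e)" for z
  show "\<exists>T. x0 \<in> T \<and> openin (top_of_set base) T \<and>
            (\<exists>v. \<Union> v = curve \<inter> fst -` T \<and> (\<forall>u\<in>v. openin (top_of_set curve) u) \<and>
                 pairwise disjnt v \<and> (\<forall>u\<in>v. \<exists>q. homeomorphism u T fst q))"
  proof (intro exI[of _ T] conjI exI[of _ "u ` Z"])
    show "x0 \<in> T" by fact
    show "openin (top_of_set base) T" using T open_base by (simp add: openin_open_eq)
    show "\<Union> (u ` Z) = curve \<inter> fst -` T"
    proof (intro subset_antisym subsetI)
      fix a assume "a \<in> curve \<inter> fst -` T"
      then obtain x y where a: "a = (x, y)" "x \<in> T" "(x, y) \<in> curve" by (cases a) auto
      then obtain z where "z \<in> Z" "y = s x z" using s_surj[of x] by (auto simp: roots_at_def curve_def)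
      then show "a \<in> \<Union> (u ` Z)" using a s[of x z] by (auto simp: u_def)
    qed (auto simp: u_def)
    show "\<forall>u\<in>u ` Z. openin (top_of_set curve) u"
      using T by (auto simp: u_def intro!: openin_open_Int open_Times)
    show "pairwise disjnt (u ` Z)"
      using sep by (fastforce simp: pairwise_def disjnt_def u_def)
    show "\<forall>u\<in>u ` Z. \<exists>q. homeomorphism u T fst q"
    proof
      fix U assume "U \<in> u ` Z"
      then obtain z where z: "z \<in> Z" "U = u z" by blast
      have "homeomorphism (u z) T fst (\<lambda>x. (x, s x z))"
        unfolding homeomorphism_def
      proof (intro conjI)
        show img: "(\<lambda>x. (x, s x z)) ` T = u z"
          using s[OF _ z(1)] s_unique[OF _ z(1)] T by (fastforce simp: u_def curve_def image_iff)
        show "\<forall>x\<in>u z. (fst x, s (fst x) z) = x" using img by force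
        show "fst ` u z = T" using img by force
      qed (use s_cont[OF z(1)] in \<open>auto intro!: continuous_intros\<close>)
      then show "\<exists>q. homeomorphism U T fst q" using z by blast
    qed
  qed
qed

end

section \<open>Branches of the curve\<close>

lemma holomorphic_on_eval2:
  assumes "a holomorphic_on A" "b holomorphic_on A"
  shows "(\<lambda>t. eval2 G (a t) (b t)) holomorphic_on A"
  unfolding eval2_eq_sum poly_altdef by (intro holomorphic_intros assms)

text \<open>The difference quotient of G in its second argument, with y^j - z^j divided by y - z
  term by term; as a polynomial expression it stays continuous on the diagonal y = z.\<close>

definition eval2_quotient :: "complex poly poly \<Rightarrow> complex \<Rightarrow> complex \<Rightarrow> complex \<Rightarrow> complex" where
  "eval2_quotient G x y z =
     (\<Sum>j\<le>degree G. poly (coeff G j) x * (\<Sum>i<j. z ^ (j - Suc i) * y ^ i))"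

lemma eval2_diff_eq: "eval2 G x y - eval2 G x z = eval2_quotient G x y z * (y - z)"
proof -
  have "eval2 G x y - eval2 G x z = (\<Sum>j\<le>degree G. poly (coeff G j) x * (y ^ j - z ^ j))"
    by (simp add: eval2_eq_sum sum_subtractf right_diff_distrib)
  also have "\<dots> = (\<Sum>j\<le>degree G. poly (coeff G j) x * (\<Sum>i<j. z ^ (j - Suc i) * y ^ i) * (y - z))"
    by (intro sum.cong refl) (simp add: power_diff_sumr2)
  finally show ?thesis by (simp add: eval2_quotient_def sum_distrib_right)
qed

text \<open>By Caratheodory's criterion, a continuous difference quotient takes the value of the
  derivative on the diagonal.\<close>

lemma eval2_quotient_diagonal: "eval2_quotient G x y y = eval2 (pderiv G) x y"
proof -
  have "(eval2 G x has_field_derivative eval2_quotient G x y y) (at y)"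
    unfolding CARAT_DERIV
    by (intro exI[of _ "\<lambda>z. eval2_quotient G x z y"] conjI allI eval2_diff_eq refl)
       (auto simp: eval2_quotient_def intro!: continuous_intros)
  moreover have "(eval2 G x has_field_derivative eval2 (pderiv G) x y) (at y)"
    using poly_DERIV[of "fiber_poly G x" y] by (simp add: poly_fiber_poly pderiv_fiber_poly)
  ultimately show ?thesis by (rule DERIV_unique)
qed

text \<open>
  A continuous root is differentiable: the exact difference quotient of \<open>G\<close> in \<open>y\<close> is continuous
  and equal to the nonzero partial derivative on the diagonal.
\<close>
lemma continuous_root_holomorphic:
  assumes "open H" "X holomorphic_on H" "continuous_on H Y"
    and root: "\<And>w. w \<in> H \<Longrightarrow> eval2 G (X w) (Y w) = 0"
    and simple: "\<And>w. w \<in> H \<Longrightarrow> eval2 (pderiv G) (X w) (Y w) \<noteq> 0"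
  shows "Y holomorphic_on H"
  unfolding holomorphic_on_open[OF assms(1)]
proof
  fix w0 assume w0: "w0 \<in> H"
  \<comment> \<open>Only the base point moves in \<phi>. Since G vanishes at (X w, Y w), the exact
    quotient gives R w (Y w - Y w0) = - (\<phi> w - \<phi> w0), which expresses the difference
    quotient of Y through that of the holomorphic \<phi>.\<close>
  define \<phi> where "\<phi> w = eval2 G (X w) (Y w0)" for w
  define R where "R w = eval2_quotient G (X w) (Y w) (Y w0)" for w
  have "\<phi> holomorphic_on H" unfolding \<phi>_def by (intro holomorphic_on_eval2 assms) auto
  then obtain c where c: "(\<phi> has_field_derivative c) (at w0)"
    using holomorphic_on_open[OF assms(1)] w0 by blast
  have contX: "isCont X w0" and contY: "isCont Y w0"
    using assms w0 continuous_on_eq_continuous_at holomorphic_on_imp_continuous_on by blast+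
  have "isCont R w0"
    unfolding R_def eval2_quotient_def by (intro continuous_intros contX contY)
  then have R: "R \<midarrow>w0\<rightarrow> R w0" by (simp add: isCont_def)
  have R0: "R w0 \<noteq> 0" using simple[OF w0] by (simp add: R_def eval2_quotient_diagonal)
  have "(\<lambda>w. - ((\<phi> w - \<phi> w0) / (w - w0)) / R w) \<midarrow>w0\<rightarrow> - c / R w0"
    using c R R0 unfolding has_field_derivative_iff by (intro tendsto_intros) auto
  moreover have "\<forall>\<^sub>F w in at w0. - ((\<phi> w - \<phi> w0) / (w - w0)) / R w = (Y w - Y w0) / (w - w0)"
  proof -
    have "\<forall>\<^sub>F w in at w0. R w \<noteq> 0"
      by (rule tendsto_imp_eventually_ne[OF R R0])
    moreover have "\<forall>\<^sub>F w in at w0. w \<in> H"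
      using assms(1) w0 by (rule eventually_at_in_open')
    moreover have "\<forall>\<^sub>F w in at w0. w \<noteq> w0" by (simp add: eventually_at_filter)
    ultimately show ?thesis
    proof eventually_elim
      case (elim w)
      have eq: "R w * (Y w - Y w0) = - (\<phi> w - \<phi> w0)"
        using eval2_diff_eq[of G "X w" "Y w" "Y w0"] root[OF elim(2)] root[OF w0]
        by (simp add: R_def \<phi>_def)
      have "- ((\<phi> w - \<phi> w0) / (w - w0)) / R w = R w * (Y w - Y w0) / (w - w0) / R w"
        by (simp only: minus_divide_left eq)
      then show ?case using elim(1) by simp
    qed
  qed
  ultimately have "(\<lambda>w. (Y w - Y w0) / (w - w0)) \<midarrow>w0\<rightarrow> - c / R w0"
    by (rule Lim_transform_eventually)
  then show "\<exists>f'. (Y has_field_derivative f') (at w0)"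
    unfolding has_field_derivative_iff by blast
qed

section \<open>Lifts of exp to the curve and their periods\<close>

context separable_curve
begin

text \<open>The preimage of the punctured disc under exp. Its convexity gives the simple
  connectivity needed to lift exp and the connectedness needed for uniqueness of lifts.\<close>

definition halfplane :: "complex set" where
  "halfplane = {w. Re w < ln \<delta>}"

definition log_branch :: "(complex \<Rightarrow> complex) \<Rightarrow> bool" where
  "log_branch Y \<longleftrightarrow> continuous_on halfplane Y \<and> (\<forall>w\<in>halfplane. eval2 G (exp w) (Y w) = 0)"

lemma open_halfplane: "open halfplane"
  unfolding halfplane_def by (rule open_halfspace_Re_lt)

lemma convex_halfplane: "convex halfplane"
  unfolding halfplane_def by (rule convex_halfspace_Re_lt)

lemma exp_in_base: "w \<in> halfplane \<Longrightarrow> exp w \<in> base"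
  using delta_pos exp_less_cancel_iff[of "Re w" "ln \<delta>"]
  by (simp add: halfplane_def base_def)

lemma log_branch_holomorphic:
  assumes "log_branch Y"
  shows "Y holomorphic_on halfplane"
proof (rule continuous_root_holomorphic[where X = exp and G = G])
  fix w assume w: "w \<in> halfplane"
  show "eval2 (pderiv G) (exp w) (Y w) \<noteq> 0"
    using assms w exp_in_base[OF w] by (intro simple_roots) (auto simp: log_branch_def base_def)
qed (use assms open_halfplane in \<open>auto simp: log_branch_def intro!: holomorphic_intros\<close>)

lemma log_branch_exists:
  assumes "w \<in> halfplane" "eval2 G (exp w) y = 0"
  obtains Y where "log_branch Y" "Y w = y"
proof -
  obtain g where g: "continuous_on halfplane g" "g \<in> halfplane \<rightarrow> curve" "g w = (exp w, y)"
    "\<And>v. v \<in> halfplane \<Longrightarrow> fst (g v) = exp v"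
  proof (rule covering_space_lift_strong[OF covering_space_curve, of "(exp w, y)" w halfplane exp])
    show "(exp w, y) \<in> curve" using assms exp_in_base by (auto simp: curve_def)
    show "simply_connected halfplane" by (rule convex_imp_simply_connected[OF convex_halfplane])
    show "locally path_connected halfplane" by (rule convex_imp_locally_path_connected[OF convex_halfplane])
    show "continuous_on halfplane exp" by (intro continuous_intros)
    show "exp \<in> halfplane \<rightarrow> base" using exp_in_base by blast
  qed (use assms in auto)
  have "log_branch (snd \<circ> g)"
    unfolding log_branch_def
  proof (intro conjI ballI)
    show "continuous_on halfplane (snd \<circ> g)" using g(1) by (auto intro!: continuous_intros simp: o_def)
    fix v assume v: "v \<in> halfplane"
    then have "g v \<in> curve" using g(2) by blast
    then show "eval2 G (exp v) ((snd \<circ> g) v) = 0"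
      using g(4)[OF v] by (auto simp: curve_def case_prod_unfold)
  qed
  then show ?thesis using that g(3) by simp
qed

lemma log_branch_unique:
  assumes "log_branch Y1" "log_branch Y2" "a \<in> halfplane" "Y1 a = Y2 a" "w \<in> halfplane"
  shows "Y1 w = Y2 w"
proof -
  have "(exp w, Y1 w) = (exp w, Y2 w)"
    by (rule covering_space_lift_unique[OF covering_space_curve, of "\<lambda>v. (exp v, Y1 v)" a
          "\<lambda>v. (exp v, Y2 v)" halfplane exp])
       (use assms exp_in_base convex_connected[OF convex_halfplane]
        in \<open>auto simp: log_branch_def curve_def intro!: continuous_intros\<close>)
  then show ?thesis by simp
qed

lemma log_branch_shift:
  assumes "log_branch Y" "exp c = 1"
  shows "log_branch (\<lambda>w. Y (w + c))"
proof -
  have "Re c = 0" using assms(2) by (metis norm_exp_eq_Re exp_eq_one_iff norm_one)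
  then have shift: "w + c \<in> halfplane \<longleftrightarrow> w \<in> halfplane" for w by (simp add: halfplane_def)
  show ?thesis
    unfolding log_branch_def
  proof (intro conjI ballI)
    show "continuous_on halfplane (\<lambda>w. Y (w + c))"
      by (rule continuous_on_compose2[of halfplane Y])
         (use assms shift in \<open>auto simp: log_branch_def intro!: continuous_intros\<close>)
    fix w assume "w \<in> halfplane"
    then show "eval2 G (exp w) (Y (w + c)) = 0"
      using assms shift[of w] unfolding log_branch_def by (metis exp_add mult_1_right)
  qed
qed

definition basepoint :: complex where
  "basepoint = of_real (ln \<delta> - 1)"

lemma basepoint_in: "basepoint \<in> halfplane" by (simp add: basepoint_def halfplane_def)

lemma log_branch_at_basepoint: "log_branch Y \<Longrightarrow> Y basepoint \<in> roots_at (exp basepoint)"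
  using basepoint_in by (simp add: log_branch_def roots_at_def)

text \<open>Every translate of Y by a multiple of 2 pi i is again a branch, and a branch is
  determined by its value at \<open>basepoint\<close>, one of finitely many roots. So two translates
  coincide, and the difference of the shifts is a period. Negative multiples are included because a
  principal logarithm may deviate in either direction.\<close>

lemma log_branch_periodic:
  assumes Y: "log_branch Y"
  obtains N :: nat where "N > 0"
    "\<And>w m. w \<in> halfplane \<Longrightarrow> Y (w + of_int (int N * m) * (2 * of_real pi * \<i>)) = Y w"
proof -
  define \<tau> :: complex where "\<tau> = 2 * of_real pi * \<i>"
  have exp_tau: "exp (of_int m * \<tau>) = 1" for m
    unfolding \<tau>_def exp_eq_1 by (auto simp: mult_ac)
  have sh: "log_branch (\<lambda>w. Y (w + of_int m * \<tau>))" for m by (rule log_branch_shift[OF Y exp_tau])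
  define h where "h j = Y (basepoint + of_int (int j) * \<tau>)" for j
  have "h j \<in> roots_at (exp basepoint)" for j
    unfolding h_def by (rule log_branch_at_basepoint[OF sh])
  then have "range h \<subseteq> roots_at (exp basepoint)" by blast
  then have "finite (range h)"
    using finite_roots_at exp_in_base basepoint_in finite_subset by blast
  then have "\<not> inj h" using finite_imageD by blast
  then obtain i j where ij: "i < j" "h i = h j"
    unfolding inj_def by (metis linorder_neqE_nat)
  define N where "N = j - i"
  have per: "Y (w + of_int (int N) * \<tau>) = Y w" if "w \<in> halfplane" for w
  proof -
    define a where "a = basepoint + of_int (int i) * \<tau>"
    have "a \<in> halfplane" using basepoint_in by (simp add: a_def \<tau>_def halfplane_def)
    moreover have shift: "a + of_int (int N) * \<tau> = basepoint + of_int (int j) * \<tau>"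
      using ij(1) by (simp add: a_def N_def algebra_simps of_nat_diff)
    moreover have "Y (a + of_int (int N) * \<tau>) = Y a"
      unfolding shift using ij(2) by (simp add: h_def a_def)
    ultimately show ?thesis
      by (intro log_branch_unique[OF sh Y _ _ that])
  qed
  have per_nat: "Y (w + of_int (int N * int m) * \<tau>) = Y w" if "w \<in> halfplane" for w m
  proof (induction m)
    case (Suc m)
    have "w + of_int (int N * int m) * \<tau> \<in> halfplane"
      using that by (simp add: halfplane_def \<tau>_def)
    from per[OF this] Suc show ?case by (simp add: algebra_simps)
  qed simp
  have "Y (w + of_int (int N * m) * \<tau>) = Y w" if w: "w \<in> halfplane" for w m
  proof (cases "m \<ge> 0")
    case True
    then show ?thesis using per_nat[OF w, of "nat m"] by simp
  next
    case False
    have "w + of_int (int N * m) * \<tau> \<in> halfplane"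
      using w by (simp add: halfplane_def \<tau>_def)
    from per_nat[OF this, of "nat (- m)"] False show ?thesis by (simp add: algebra_simps)
  qed
  then show ?thesis using that[of N] ij(1) by (simp add: N_def \<tau>_def)
qed

text \<open>With x = t^N a logarithm of x is N log t, and changing the choice of log t adds a
  multiple of the period of Y. So Y (N log t) depends on t alone and is holomorphic also across the
  cut where \<open>Ln\<close> jumps.\<close>

lemma puiseux_branch:
  assumes Y: "log_branch Y"
  obtains N p r where "N > 0" "r > 0" "p holomorphic_on ball 0 r - {0}"
    "\<And>w. exp w \<in> ball 0 r \<Longrightarrow> of_nat N * w \<in> halfplane \<and> p (exp w) = Y (of_nat N * w)"
proof -
  obtain N :: nat where N: "N > 0"
    and per: "\<And>w m. w \<in> halfplane \<Longrightarrow> Y (w + of_int (int N * m) * (2 * of_real pi * \<i>)) = Y w"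
    using log_branch_periodic[OF Y] by blast
  \<comment> \<open>For nonzero t, |t| < r means |t^N| < \<delta>, which puts N log t into the half
    plane.\<close>
  define r where "r = root N \<delta>"
  have "r > 0" using N delta_pos by (simp add: r_def)
  define p where "p t = Y (of_nat N * Ln t)" for t
  have in_half: "of_nat N * w \<in> halfplane" if "exp w \<in> ball 0 r" for w
  proof -
    have "exp (Re w) < root N \<delta>" using that by (simp add: r_def)
    then have "exp (Re w) ^ N < root N \<delta> ^ N" using N by (intro power_strict_mono) auto
    then have "exp (real N * Re w) < \<delta>" using N delta_pos by (simp add: exp_of_nat_mult)
    then have "real N * Re w < ln \<delta>" using delta_pos by (metis exp_less_cancel_iff exp_ln)
    then show ?thesis by (simp add: halfplane_def)
  qed
  have p_exp: "p (exp w) = Y (of_nat N * w)" if w: "exp w \<in> ball 0 r" for w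
  proof -
    have "exp (Ln (exp w)) = exp w" by simp
    then obtain m :: int where "Ln (exp w) = w + (of_int (2 * m) * pi) * \<i>" unfolding exp_eq by blast
    then have "of_nat N * Ln (exp w) = of_nat N * w + of_int (int N * m) * (2 * of_real pi * \<i>)"
      by (simp add: algebra_simps)
    then show ?thesis using per[OF in_half[OF w]] by (simp add: p_def)
  qed
  have "p field_differentiable at t0" if t0: "t0 \<in> ball 0 r - {0}" for t0
  proof -
    \<comment> \<open>On U the quotient t / t0 has positive real part, so \<open>l\<close> is a
      holomorphic logarithm near t0 even if t0 lies on the cut of \<open>Ln\<close>.\<close>
    define U where "U = ball t0 (norm t0) \<inter> ball 0 r"
    define l where "l t = Ln (t / t0) + Ln t0" for t
    have t0': "t0 \<noteq> 0" using t0 by simp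
    have near: "t \<noteq> 0 \<and> t / t0 \<notin> \<real>\<^sub>\<le>\<^sub>0" if "t \<in> U" for t
    proof -
      have "norm (t0 - t) < norm t0" using that by (simp add: U_def dist_norm)
      then have "norm ((t0 - t) / t0) < 1" using t0' by (simp add: norm_divide)
      then have "norm (1 - t / t0) < 1" using t0' by (simp add: diff_divide_distrib)
      then have "Re (t / t0) > 0" using abs_Re_le_cmod[of "1 - t / t0"] by simp
      then show ?thesis by (auto simp: complex_nonpos_Reals_iff)
    qed
    have "l holomorphic_on U"
      unfolding l_def using near t0' by (intro holomorphic_intros) auto
    moreover have exp_l: "exp (l t) = t" if "t \<in> U" for t
      using near[OF that] t0' by (simp add: l_def exp_add)
    moreover have "of_nat N * l t \<in> halfplane" if "t \<in> U" for t
      using in_half[of "l t"] exp_l[OF that] that by (simp add: U_def)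
    ultimately have "(\<lambda>t. Y (of_nat N * l t)) holomorphic_on U"
      by (intro holomorphic_on_compose_gen[OF _ log_branch_holomorphic[OF Y], unfolded o_def])
         (auto intro!: holomorphic_intros)
    moreover have "Y (of_nat N * l t) = p t" if "t \<in> U" for t
      using p_exp[of "l t"] exp_l[OF that] that by (simp add: U_def)
    ultimately have "p holomorphic_on U" by (rule holomorphic_transform)
    moreover have "open U" "t0 \<in> U" using t0 by (auto simp: U_def)
    ultimately show ?thesis by (rule holomorphic_on_imp_differentiable_at)
  qed
  then have "p holomorphic_on ball 0 r - {0}"
    by (simp add: holomorphic_on_def field_differentiable_at_within)
  then show ?thesis using that[OF N \<open>r > 0\<close>] in_half p_exp by blast
qed

end

section \<open>Parametrisation by Puiseux series\<close>

lemma norm_poly_le_sum_coeffs: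
  fixes q :: "complex poly"
  assumes "norm x \<le> 1"
  shows "norm (poly q x) \<le> (\<Sum>i\<le>degree q. norm (coeff q i))"
  unfolding poly_altdef
proof (intro sum_norm_le)
  fix i
  have "norm (coeff q i) * norm x ^ i \<le> norm (coeff q i) * 1"
    using assms by (intro mult_left_mono power_le_one) auto
  then show "norm (coeff q i * x ^ i) \<le> norm (coeff q i)" by (simp add: norm_mult norm_power)
qed

text \<open>For |y| > 1, solve the equation for its leading term and divide by y^(D-1). The bound
  shows that a branch times the leading coefficient has a removable singularity, so the branch
  itself is at worst meromorphic at 0.\<close>

lemma eval2_root_bound:
  fixes G :: "complex poly poly"
  assumes "degree G > 0"
  obtains B where "\<And>x y. norm x \<le> 1 \<Longrightarrow> eval2 G x y = 0 \<Longrightarrow> norm (poly (lead_coeff G) x * y) \<le> B"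
proof -
  define b where "b j = (\<Sum>i\<le>degree (coeff G j). norm (coeff (coeff G j) i))" for j
  define D where "D = degree G"
  have b: "norm (poly (coeff G j) x) \<le> b j" if "norm x \<le> 1" for j x
    unfolding b_def by (rule norm_poly_le_sum_coeffs[OF that])
  have b0: "b j \<ge> 0" for j unfolding b_def by (intro sum_nonneg) auto
  have "norm (poly (lead_coeff G) x * y) \<le> sum b {..D}" if x: "norm x \<le> 1" and root: "eval2 G x y = 0" for x y
  proof (cases "norm y \<le> 1")
    case True
    then have "norm (poly (lead_coeff G) x) * norm y \<le> b D * 1"
      using b[OF x] b0 by (intro mult_mono) (auto simp: D_def)
    also have "\<dots> \<le> sum b {..D}" using b0 by (simp add: member_le_sum)
    finally show ?thesis by (simp add: norm_mult)
  next
    case False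
    have "poly (lead_coeff G) x * y ^ D + (\<Sum>j<D. poly (coeff G j) x * y ^ j) = 0"
      using root by (simp add: eval2_eq_sum D_def lessThan_Suc_atMost[symmetric] add.commute)
    then have "poly (lead_coeff G) x * y * y ^ (D - 1) = - (\<Sum>j<D. poly (coeff G j) x * y ^ j)"
      using assms by (simp add: D_def eq_neg_iff_add_eq_0 power_eq_if mult.assoc)
    then have "norm (poly (lead_coeff G) x * y * y ^ (D - 1)) = norm (\<Sum>j<D. poly (coeff G j) x * y ^ j)"
      by simp
    also have "\<dots> \<le> (\<Sum>j<D. b j * norm y ^ (D - 1))"
    proof (intro sum_norm_le)
      fix j assume "j \<in> {..<D}"
      then have "norm (poly (coeff G j) x) * norm y ^ j \<le> b j * norm y ^ (D - 1)"
        using False b[OF x] b0 by (intro mult_mono power_increasing) auto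
      then show "norm (poly (coeff G j) x * y ^ j) \<le> b j * norm y ^ (D - 1)"
        by (simp add: norm_mult norm_power)
    qed
    also have "\<dots> = (\<Sum>j<D. b j) * norm y ^ (D - 1)" by (simp add: sum_distrib_right)
    finally have "norm (poly (lead_coeff G) x * y) * norm y ^ (D - 1) \<le> (\<Sum>j<D. b j) * norm y ^ (D - 1)"
      by (simp add: norm_mult norm_power)
    moreover have "norm y ^ (D - 1) > 0" using False by (intro zero_less_power) linarith
    ultimately have "norm (poly (lead_coeff G) x * y) \<le> (\<Sum>j<D. b j)"
      by (rule mult_right_le_imp_le)
    also have "\<dots> \<le> sum b {..D}" using b0 by (intro sum_mono2) auto
    finally show ?thesis .
  qed
  then show ?thesis using that by blast
qed

lemma laurent_leading_coeff_tendsto: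
  assumes "f has_laurent_expansion L" "L \<noteq> 0"
  obtains c where "c \<noteq> 0" "((\<lambda>z. f z / z powi fls_subdegree L) \<longlongrightarrow> c) (at 0)"
proof -
  define c where "c = fls_nth L (fls_subdegree L)"
  define g where "g z = c * z powi fls_subdegree L" for z
  have c: "c \<noteq> 0" using assms by (simp add: c_def)
  have "((\<lambda>x. if f x = 0 \<and> g x = 0 then 1 else f x / g x) \<longlongrightarrow> 1) (at 0)"
    using has_laurent_expansion_imp_asymp_equiv_0[OF assms(1)]
    unfolding asymp_equiv_def g_def c_def .
  then have "((\<lambda>x. (if f x = 0 \<and> g x = 0 then 1 else f x / g x) * c) \<longlongrightarrow> 1 * c) (at 0)"
    by (intro tendsto_intros)
  moreover have "\<forall>\<^sub>F x in at 0. (if f x = 0 \<and> g x = 0 then 1 else f x / g x) * c = f x / x powi fls_subdegree L"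
    using c by (auto simp: eventually_at_filter g_def)
  ultimately have "((\<lambda>z. f z / z powi fls_subdegree L) \<longlongrightarrow> c) (at 0)"
    by (auto intro: Lim_transform_eventually)
  then show ?thesis using that c by blast
qed

lemma fps_leading_coeff_tendsto:
  fixes f :: "complex \<Rightarrow> complex"
  assumes "f has_fps_expansion F" "F \<noteq> 0"
  obtains c where "c \<noteq> 0" "((\<lambda>z. f z / z ^ subdegree F) \<longlongrightarrow> c) (at 0)"
proof -
  obtain c where "c \<noteq> 0" "((\<lambda>z. f z / z powi fls_subdegree (fps_to_fls F)) \<longlongrightarrow> c) (at 0)"
    by (rule laurent_leading_coeff_tendsto[OF has_laurent_expansion_fps[OF assms(1)]])
       (use assms in auto)
  then show ?thesis using that by (simp add: fls_subdegree_fls_to_fps)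
qed

text \<open>The identity theorem for sampled values: the leading term of a nonzero expansion keeps f
  from vanishing on a punctured neighbourhood of 0, which contains almost all
  \<open>t k\<close>.\<close>

lemma fps_eq_0_if_zeros_accumulate:
  fixes f :: "complex \<Rightarrow> complex"
  assumes F: "f has_fps_expansion F" and t: "filterlim t (at 0) sequentially"
    and zero: "infinite {k. f (t k) = 0}"
  shows "F = 0"
proof (rule ccontr)
  assume "F \<noteq> 0"
  from fps_leading_coeff_tendsto[OF F this]
  obtain c where c: "c \<noteq> 0" "((\<lambda>z. f z / z ^ subdegree F) \<longlongrightarrow> c) (at 0)" by blast
  have "\<forall>\<^sub>F z in at 0. f z / z ^ subdegree F \<noteq> 0" by (rule tendsto_imp_eventually_ne[OF c(2,1)])
  then have "\<forall>\<^sub>F k in sequentially. f (t k) / t k ^ subdegree F \<noteq> 0"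
    using t by (rule eventually_compose_filterlim)
  then have "\<forall>\<^sub>F k in sequentially. f (t k) \<noteq> 0" by eventually_elim auto
  then show False using zero by (simp add: eventually_cofinite flip: cofinite_eq_sequentially)
qed

text \<open>Near 0 the size of p is that of its leading term; a leading exponent below N would
  eventually exceed C |z|^N. This rules out poles and all exponents of x below 1.\<close>

lemma laurent_subdegree_ge:
  assumes L: "p has_laurent_expansion L" "L \<noteq> 0"
    and t: "filterlim t (at 0) sequentially"
    and bound: "infinite {k. norm (p (t k)) \<le> C * norm (t k) ^ N}"
  shows "int N \<le> fls_subdegree L"
proof (rule ccontr)
  define n where "n = fls_subdegree L"
  assume "\<not> ?thesis"
  then have n: "n < int N" by (simp add: n_def)
  obtain c where c: "c \<noteq> 0" "((\<lambda>z. p z / z powi n) \<longlongrightarrow> c) (at 0)"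
    using laurent_leading_coeff_tendsto[OF L] unfolding n_def by blast
  \<comment> \<open>After division by |z|^n the second term still carries the positive power N - n
    and vanishes in the limit, leaving |c| > 0.\<close>
  have "((\<lambda>z. norm (p z / z powi n) - C * norm z ^ nat (int N - n)) \<longlongrightarrow> norm c - C * norm (0::complex) ^ nat (int N - n)) (at 0)"
    by (intro tendsto_intros c)
  then have "((\<lambda>z. norm (p z / z powi n) - C * norm z ^ nat (int N - n)) \<longlongrightarrow> norm c) (at 0)"
    using n by (simp add: zero_power)
  then have "\<forall>\<^sub>F z in at 0. norm (p z / z powi n) - C * norm z ^ nat (int N - n) > 0"
    using c(1) by (intro order_tendstoD(1)) auto
  moreover have "\<forall>\<^sub>F z in at (0::complex). z \<noteq> 0" by (simp add: eventually_at_filter)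
  ultimately have "\<forall>\<^sub>F z in at 0. norm (p z) > C * norm z ^ N"
  proof eventually_elim
    case (elim z)
    have "norm z ^ N = norm z powi ((int N - n) + n)" by simp
    also have "\<dots> = norm z powi (int N - n) * norm z powi n"
      using elim by (intro power_int_add) auto
    also have "norm z powi (int N - n) = norm z ^ nat (int N - n)"
      using n by (simp add: power_int_def)
    finally have eq: "norm z ^ N = norm z ^ nat (int N - n) * norm z powi n" .
    have pos: "norm z powi n > 0" using elim by simp
    have "C * norm z ^ nat (int N - n) < norm (p z) / norm z powi n"
      using elim(1) by (simp add: norm_divide norm_power_int)
    then show ?case using pos by (simp add: eq pos_less_divide_eq mult.assoc)
  qed
  then have "\<forall>\<^sub>F k in sequentially. norm (p (t k)) > C * norm (t k) ^ N"
    using t by (rule eventually_compose_filterlim)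
  then show False
    using bound by (simp add: eventually_cofinite not_less flip: cofinite_eq_sequentially)
qed

lemma finite_preimage_of_limit:
  fixes X :: "nat \<Rightarrow> 'a::t1_space"
  assumes "X \<longlonglongrightarrow> l" "r \<noteq> l"
  shows "finite {k. X k = r}"
proof -
  have "\<forall>\<^sub>F k in sequentially. X k \<noteq> r" by (rule tendsto_imp_eventually_ne[OF assms(1)]) (use assms in auto)
  then show ?thesis by (simp add: eventually_cofinite flip: cofinite_eq_sequentially)
qed

lemma poly_zero_set_nhd:
  fixes q :: "complex poly"
  assumes "q \<noteq> 0"
  obtains \<delta> where "\<delta> > 0" "\<And>x. x \<noteq> 0 \<Longrightarrow> norm x < \<delta> \<Longrightarrow> poly q x \<noteq> 0"
proof -
  obtain \<delta> where "\<delta> > 0" "\<forall>x\<in>{x. poly q x = 0}. x \<noteq> 0 \<longrightarrow> \<delta> \<le> dist 0 x"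
    using finite_set_avoid[OF poly_roots_finite[OF assms], of 0] by blast
  then have "poly q x \<noteq> 0" if "x \<noteq> 0" "norm x < \<delta>" for x using that by auto
  then show ?thesis using that[of \<delta>] \<open>\<delta> > 0\<close> by blast
qed

text \<open>The series produced may still have exponents sharing a divisor with N, and nothing is
  claimed about F along it; both matters are settled later from the infinitely many points it
  meets.\<close>

proposition complex_puiseux_parametrization:
  fixes F :: "complex poly poly" and x :: "nat \<Rightarrow> real" and Y :: "nat \<Rightarrow> complex"
  assumes F: "F \<noteq> 0" "\<And>k. eval2 F (of_real (x k)) (Y k) = 0"
    and x: "\<And>k. x k > 0" "x \<longlonglongrightarrow> 0"
    and Y: "\<And>k. norm (Y k) \<le> C * x k"
  obtains N p where "N > 0" "fps_conv_radius p > 0" "\<And>k. k < N \<Longrightarrow> fps_nth p k = 0"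
    "infinite {k. eval_fps p (of_real (root N (x k))) = Y k}"
proof -
  have fin: "finite {k. poly q (of_real (x k)) = 0}" if "q \<noteq> 0" for q :: "complex poly"
  proof -
    have "(\<lambda>k. complex_of_real (x k)) \<longlonglongrightarrow> 0" using x(2) tendsto_of_real by fastforce
    then have "finite {k. complex_of_real (x k) = z}" for z
      using finite_preimage_of_limit[of "\<lambda>k. complex_of_real (x k)" 0 z] x(1)
      by (cases "z = 0") (auto simp: less_imp_neq[THEN not_sym])
    then have "finite (\<Union>z\<in>{z. poly q z = 0}. {k. complex_of_real (x k) = z})"
      by (intro finite_UN_I poly_roots_finite that)
    then show ?thesis by (rule finite_subset[rotated]) auto
  qed
  obtain G A B d where G: "infinite {k. eval2 G (of_real (x k)) (Y k) = 0}" "degree G > 0"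
    and d: "d \<noteq> 0" "A * G + B * pderiv G = [:d:]"
    by (rule exists_separable_factor[where X = "\<lambda>k. of_real (x k)" and Y = Y, OF F fin])
  have "lead_coeff G * d \<noteq> 0" using d G by auto
  from poly_zero_set_nhd[OF this] obtain \<delta> where \<delta>: "\<delta> > 0" "\<And>x. x \<noteq> 0 \<Longrightarrow> norm x < \<delta> \<Longrightarrow> poly (lead_coeff G * d) x \<noteq> 0"
    by blast
  interpret separable_curve G \<delta>
  proof
    fix x y :: complex assume xy: "x \<noteq> 0" "norm x < \<delta>" "eval2 G x y = 0"
    show "eval2 (pderiv G) x y \<noteq> 0"
    proof
      assume "eval2 (pderiv G) x y = 0"
      then have "eval2 (A * G + B * pderiv G) x y = 0" using xy by (simp add: eval2_add eval2_mult)
      then show False using \<delta>(2)[OF xy(1,2)] by (simp add: d eval2_const)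
    qed
  next
    show "poly (lead_coeff G) x \<noteq> 0" if "x \<noteq> 0" "norm x < \<delta>" for x
      using \<delta>(2)[OF that] by simp
  qed (rule \<delta>(1) G(2))+
  have small: "finite {k. \<not> x k < b}" if "b > 0" for b
    using order_tendstoD(2)[OF x(2) that] by (simp add: eventually_cofinite flip: cofinite_eq_sequentially)
  define K where "K = {k. eval2 G (of_real (x k)) (Y k) = 0 \<and> x k < \<delta>}"
  have "{k. eval2 G (of_real (x k)) (Y k) = 0} \<subseteq> K \<union> {k. \<not> x k < \<delta>}" by (auto simp: K_def)
  then have infK: "infinite K" using G(1) small[OF \<delta>(1)] finite_subset finite_UnI by blast
  have lnx: "exp (of_real (ln (x k))) = complex_of_real (x k)" for k
    using x(1)[of k] by (simp flip: of_real_exp)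
  have ln_in: "of_real (ln (x k)) \<in> halfplane" if "k \<in> K" for k
    using that x(1)[of k] \<delta>(1) by (simp add: K_def halfplane_def)
  have "\<exists>L. log_branch L \<and> L (of_real (ln (x k))) = Y k" if "k \<in> K" for k
    using log_branch_exists[OF ln_in[OF that], of "Y k"] that lnx by (auto simp: K_def)
  then obtain L where L: "\<And>k. k \<in> K \<Longrightarrow> log_branch (L k)" "\<And>k. k \<in> K \<Longrightarrow> L k (of_real (ln (x k))) = Y k"
    by metis
  have "(\<lambda>k. L k basepoint) ` K \<subseteq> roots_at (exp basepoint)"
    using L log_branch_at_basepoint by blast
  then have "finite ((\<lambda>k. L k basepoint) ` K)"
    using finite_roots_at exp_in_base basepoint_in finite_subset by blast
  \<comment> \<open>The lift through each point is determined by its value at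
    \<open>basepoint\<close>; with finitely many values available, infinitely many points lie on one
    lift.\<close>
  then obtain k0 where k0: "k0 \<in> K" "infinite {k \<in> K. L k basepoint = L k0 basepoint}"
    using pigeonhole_infinite[OF infK] by blast
  define Z where "Z = L k0"
  have Z: "log_branch Z" using L k0 by (simp add: Z_def)
  have ZY: "Z (of_real (ln (x k))) = Y k" if k: "k \<in> K" "L k basepoint = L k0 basepoint" for k
    using log_branch_unique[OF Z L(1)[OF k(1)] basepoint_in _ ln_in[OF k(1)]] L(2)[OF k(1)] k(2)
    by (simp add: Z_def)
  obtain N p r where N: "N > 0" "r > 0" "p holomorphic_on ball 0 r - {0}"
    and p: "\<And>w. exp w \<in> ball 0 r \<Longrightarrow> of_nat N * w \<in> halfplane \<and> p (exp w) = Z (of_nat N * w)"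
    by (rule puiseux_branch[OF Z]) blast
  have p_root: "eval2 G (t ^ N) (p t) = 0" if "t \<in> ball 0 r - {0}" for t
  proof -
    have t: "exp (Ln t) = t" using that by simp
    have "exp (of_nat N * Ln t) = t ^ N" using t by (simp add: exp_of_nat_mult)
    then show ?thesis using p[of "Ln t"] t that Z by (auto simp: log_branch_def)
  qed
  define K' where "K' = {k \<in> K. L k basepoint = L k0 basepoint} - {k. \<not> x k < r ^ N}"
  have infK': "infinite K'"
    unfolding K'_def using k0(2) small[of "r ^ N"] N(2) by simp
  define t where "t k = complex_of_real (root N (x k))" for k
  have pY: "p (t k) = Y k" if k: "k \<in> K'" for k
  proof -
    have "exp (ln (x k) / N) = root N (x k)"
      using N(1) x(1)[of k] by (intro real_root_pos_unique[symmetric]) (auto simp flip: exp_of_nat_mult)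
    then have e: "exp (of_real (ln (x k) / N)) = t k" by (simp only: t_def exp_of_real)
    have "root N (x k) < root N (r ^ N)" using k N(1) by (simp add: K'_def)
    then have "t k \<in> ball 0 r" using N x(1)[of k] by (simp add: t_def real_root_power_cancel)
    then have "p (t k) = Z (of_nat N * of_real (ln (x k) / N))"
      using p[of "of_real (ln (x k) / N)"] unfolding e by blast
    then show ?thesis using ZY[of k] N(1) k by (simp add: K'_def)
  qed
  have "(\<lambda>k. root N (x k)) \<longlonglongrightarrow> root N 0" by (intro tendsto_intros x)
  then have t_lim: "filterlim t (at 0) sequentially"
    using N(1) x(1) tendsto_of_real[of "\<lambda>k. root N (x k)" 0 sequentially, where 'a = complex]
    by (auto simp: filterlim_at t_def[abs_def] less_imp_neq[THEN not_sym])
  \<comment> \<open>Multiplying by the leading coefficient makes the branch bounded, so the product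
    extends over 0; dividing the expansions gives a Laurent series for p.\<close>
  define a where "a t = poly (lead_coeff G) (t ^ N)" for t
  obtain b where b: "\<And>x y. norm x \<le> 1 \<Longrightarrow> eval2 G x y = 0 \<Longrightarrow> norm (poly (lead_coeff G) x * y) \<le> b"
    by (rule eval2_root_bound[OF G(2)]) blast
  have "(\<lambda>t. a t * p t) holomorphic_on ball 0 r - {0}"
    unfolding a_def poly_altdef by (intro holomorphic_intros N)
  moreover have "\<forall>\<^sub>F t in at 0. norm (a t * p t) \<le> b"
  proof -
    have "\<forall>\<^sub>F t in at (0::complex). t \<in> ball 0 (min r 1) - {0}"
      using N(2) by (intro eventually_at_in_open) auto
    then show ?thesis
    proof eventually_elim
      case (elim t)
      then show ?case unfolding a_def by (intro b p_root) (auto simp: norm_power power_le_one)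
    qed
  qed
  ultimately obtain h where h: "h holomorphic_on ball 0 r" "\<And>t. t \<in> ball 0 r - {0} \<Longrightarrow> h t = a t * p t"
    using holomorphic_on_extend_bounded[of "\<lambda>t. a t * p t" "ball 0 r" 0] N(2) by auto
  have "h analytic_on {0}" using h(1) N(2) analytic_at by (metis centre_in_ball open_ball)
  then have hL: "h has_laurent_expansion fps_to_fls (fps_expansion h 0)"
    by (intro has_laurent_expansion_fps analytic_at_imp_has_fps_expansion_0)
  have "a analytic_on {0}"
    unfolding a_def poly_altdef by (intro analytic_intros)
  then have aL: "a has_laurent_expansion fps_to_fls (fps_expansion a 0)"
    by (intro has_laurent_expansion_fps analytic_at_imp_has_fps_expansion_0)
  define M where "M = fps_to_fls (fps_expansion h 0) / fps_to_fls (fps_expansion a 0)"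
  have "(\<lambda>t. h t / a t) has_laurent_expansion M"
    unfolding M_def by (rule has_laurent_expansion_divide[OF hL aL])
  moreover have "\<forall>\<^sub>F t in at 0. h t / a t = p t"
  proof -
    have "((\<lambda>t::complex. norm (t ^ N)) \<longlongrightarrow> norm ((0::complex) ^ N)) (at 0)" by (intro tendsto_intros)
    then have "((\<lambda>t::complex. norm (t ^ N)) \<longlongrightarrow> 0) (at 0)"
      using N(1) by (simp add: zero_power)
    from order_tendstoD(2)[OF this \<delta>(1)]
    have "\<forall>\<^sub>F t in at (0::complex). norm (t ^ N) < \<delta>" .
    moreover have "\<forall>\<^sub>F t in at (0::complex). t \<in> ball 0 r - {0}"
      using N(2) by (intro eventually_at_in_open) auto
    ultimately show ?thesis
    proof eventually_elim
      case (elim t)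
      then have "a t \<noteq> 0" using lead_coeff_nz[of "t ^ N"] by (auto simp: a_def)
      then show ?case using h(2)[OF elim(2)] by simp
    qed
  qed
  ultimately have M: "p has_laurent_expansion M"
    using has_laurent_expansion_cong[of "\<lambda>t. h t / a t" p M M] by simp
  have "norm (t k) ^ N = x k" for k
    using N(1) x(1)[of k] by (simp add: t_def real_root_pow_pos2 less_imp_le)
  then have "K' \<subseteq> {k. norm (p (t k)) \<le> C * norm (t k) ^ N}"
    using pY Y by auto
  then have bound: "infinite {k. norm (p (t k)) \<le> C * norm (t k) ^ N}"
    using infK' finite_subset by blast
  have M_nth: "fls_nth M i = 0" if "i < int N" for i
  proof (cases "M = 0")
    case False
    then show ?thesis using laurent_subdegree_ge[OF M False t_lim bound] that by (intro fls_eq0_below_subdegree) auto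
  qed auto
  define P where "P = fls_regpart M"
  have MP: "fps_to_fls P = M"
    using M_nth by (intro fls_eqI) (auto simp: P_def)
  \<comment> \<open>The branch is controlled only away from 0, so its value at 0 is replaced by the
    constant coefficient.\<close>
  have "(\<lambda>t. if t = 0 then fps_nth P 0 else p t) has_fps_expansion P"
    unfolding has_fps_expansion_to_laurent MP
    using M by (subst has_laurent_expansion_cong[where g = p and G = M]) (auto simp: eventually_at_filter)
  then have P: "fps_conv_radius P > 0" "\<forall>\<^sub>F t in nhds 0. eval_fps P t = (if t = 0 then fps_nth P 0 else p t)"
    by (auto simp: has_fps_expansion_def)
  have "\<forall>\<^sub>F t in at 0. eval_fps P t = p t"
    using P(2) by (auto simp: eventually_at_filter elim!: eventually_mono)
  then have "\<forall>\<^sub>F k in sequentially. eval_fps P (t k) = p (t k)"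
    using t_lim by (rule eventually_compose_filterlim)
  then have "finite {k. eval_fps P (t k) \<noteq> p (t k)}"
    by (simp add: eventually_cofinite flip: cofinite_eq_sequentially)
  then have "infinite (K' - {k. eval_fps P (t k) \<noteq> p (t k)})" using infK' by simp
  moreover have "K' - {k. eval_fps P (t k) \<noteq> p (t k)} \<subseteq> {k. eval_fps P (of_real (root N (x k))) = Y k}"
    using pY by (auto simp: t_def)
  ultimately have "infinite {k. eval_fps P (of_real (root N (x k))) = Y k}"
    using finite_subset by blast
  then show ?thesis
    using that[OF N(1) P(1)] M_nth by (simp add: P_def)
qed

section \<open>From real to complex polynomials, and from formal series to functions\<close>

definition complexify :: "real poly poly \<Rightarrow> complex poly poly" where
  "complexify h = map_poly (map_poly of_real) h"

lemma poly2_eq_eval2: "poly2 h a b = eval2 h a b"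
  by (simp add: poly2_def eval2_def)

lemma complexify_eq_0_iff: "complexify h = 0 \<longleftrightarrow> h = 0"
  unfolding complexify_def by (rule map_poly_eq_0_iff) (auto simp: map_poly_eq_0_iff)

lemma complexify_0: "complexify 0 = 0"
  by (simp add: complexify_def)

lemma complexify_pCons: "complexify (pCons q h) = pCons (map_poly of_real q) (complexify h)"
  by (simp add: complexify_def map_poly_pCons)

lemma poly_map_of_real: "poly (map_poly of_real q) (of_real a :: complex) = of_real (poly q a)"
  by (induction q) (auto simp: map_poly_pCons)

lemma eval2_complexify: "eval2 (complexify h) (of_real a) (of_real b) = of_real (poly2 h a b)"
  unfolding poly2_eq_eval2
  by (induction h) (auto simp: complexify_pCons eval2_pCons poly_map_of_real eval2_0 complexify_0)

lemma poly2_scale_x: "poly2 (scale_x s h) a b = poly2 h (s * a) b"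
  unfolding poly2_eq_eval2
  by (induction h) (auto simp: scale_x_def map_poly_pCons eval2_pCons poly_pcompose eval2_0 mult.commute)

lemma scale_x_nonzero: "h \<noteq> 0 \<Longrightarrow> s \<noteq> 0 \<Longrightarrow> scale_x s h \<noteq> 0"
  unfolding scale_x_def by (subst map_poly_eq_0_iff) (auto simp: pcompose_eq_0_iff)

text \<open>Expansions are stable under sums and products, so an induction over both layers of the
  polynomial applies. This bridge lets the formal substitution be tested by its values.\<close>

lemma puiseux_subst_has_fps_expansion:
  assumes "fps_conv_radius p > 0"
  shows "(\<lambda>t. eval2 (complexify h) (t ^ n) (eval_fps p t)) has_fps_expansion puiseux_subst h (n, p)"
proof -
  define c :: "real \<Rightarrow> complex fps" where "c = (\<lambda>a. fps_const (of_real a))"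
  define A where "A = (\<lambda>q. poly (map_poly c q) (fps_X ^ n))"
  have A0: "A 0 = 0" by (simp add: A_def)
  have A: "(\<lambda>t. poly (map_poly of_real q) (t ^ n)) has_fps_expansion A q" for q
  proof (induction q)
    case 0
    show ?case by (simp add: A0)
  next
    case (pCons a q)
    have "A (pCons a q) = fps_const (of_real a) + fps_X ^ n * A q"
      by (simp add: A_def map_poly_pCons c_def)
    moreover have "(\<lambda>t. of_real a + t ^ n * poly (map_poly of_real q) (t ^ n))
        has_fps_expansion (fps_const (of_real a) + fps_X ^ n * A q)"
      by (intro fps_expansion_intros pCons)
    ultimately show ?case by (simp add: map_poly_pCons)
  qed
  have "(\<lambda>t. eval2 (complexify h) (t ^ n) (eval_fps p t)) has_fps_expansion poly (map_poly A h) p"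
  proof (induction h)
    case 0
    show ?case by (simp add: complexify_0 eval2_0)
  next
    case (pCons q h)
    have "(\<lambda>t. poly (map_poly of_real q) (t ^ n) + eval_fps p t * eval2 (complexify h) (t ^ n) (eval_fps p t))
        has_fps_expansion (A q + p * poly (map_poly A h) p)"
      by (intro fps_expansion_intros A pCons eval_fps_has_fps_expansion assms)
    then show ?case by (simp add: complexify_pCons eval2_pCons map_poly_pCons A0)
  qed
  then show ?thesis by (simp add: puiseux_subst_def A_def c_def)
qed

lemma fps_ratio_tendsto:
  fixes f g :: "complex \<Rightarrow> complex"
  assumes F: "f has_fps_expansion F" "F \<noteq> 0" and G: "g has_fps_expansion G" "G \<noteq> 0"
    and le: "subdegree G \<le> subdegree F"
  obtains l where "((\<lambda>t. f t / g t) \<longlongrightarrow> l) (at 0)" "subdegree G < subdegree F \<Longrightarrow> l = 0"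
proof -
  define e where "e = subdegree F - subdegree G"
  obtain a where a: "a \<noteq> 0" "((\<lambda>z. f z / z ^ subdegree F) \<longlongrightarrow> a) (at 0)"
    by (rule fps_leading_coeff_tendsto[OF F]) blast
  obtain b where b: "b \<noteq> 0" "((\<lambda>z. g z / z ^ subdegree G) \<longlongrightarrow> b) (at 0)"
    by (rule fps_leading_coeff_tendsto[OF G]) blast
  \<comment> \<open>The factor \<open>0 ^ e\<close> is 1 for equal orders and 0 otherwise.\<close>
  have "((\<lambda>z. (f z / z ^ subdegree F) / (g z / z ^ subdegree G) * z ^ e) \<longlongrightarrow> a / b * 0 ^ e) (at 0)"
    by (intro tendsto_intros a b)
  moreover have "\<forall>\<^sub>F z in at 0. (f z / z ^ subdegree F) / (g z / z ^ subdegree G) * z ^ e = f z / g z"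
  proof -
    have "(f z / z ^ subdegree F) / (g z / z ^ subdegree G) * z ^ e = f z / g z" if "z \<noteq> 0" for z
    proof -
      have "z ^ subdegree F = z ^ subdegree G * z ^ e" using le by (simp add: e_def flip: power_add)
      then show ?thesis using that by simp
    qed
    then show ?thesis by (auto simp: eventually_at_filter)
  qed
  ultimately have "((\<lambda>t. f t / g t) \<longlongrightarrow> a / b * 0 ^ e) (at 0)"
    by (rule Lim_transform_eventually)
  then show ?thesis using that by (force simp: e_def zero_power)
qed

text \<open>Schwarz reflection: the series with conjugated coefficients represents cnj (f (cnj z)),
  which agrees with f at the sampled real points, so the two series are equal.\<close>

lemma fps_coeffs_real_if_real_values:
  fixes p :: "complex fps"
  assumes p: "fps_conv_radius p > 0" and t: "filterlim t (at 0) sequentially" "\<And>k. t k \<in> \<real>"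
    and real_values: "infinite {k. eval_fps p (t k) \<in> \<real>}"
  shows "fps_nth p k \<in> \<real>"
proof -
  define f where "f = eval_fps p"
  define q where "q = Abs_fps (\<lambda>k. cnj (fps_nth p k))"
  have "(\<lambda>z. cnj (f (cnj z))) has_fps_expansion q"
  proof (rule has_fps_expansionI)
    have "\<forall>\<^sub>F u in nhds (0::complex). u \<in> eball 0 (fps_conv_radius p)"
      by (intro eventually_nhds_in_open) (use p in \<open>auto simp: zero_ereal_def\<close>)
    then show "\<forall>\<^sub>F u in nhds 0. (\<lambda>n. fps_nth q n * u ^ n) sums cnj (f (cnj u))"
    proof eventually_elim
      case (elim u)
      then have "(\<lambda>n. fps_nth p n * cnj u ^ n) sums f (cnj u)"
        unfolding f_def by (intro sums_eval_fps) (auto simp: in_eball_iff)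
      then have "(\<lambda>n. cnj (fps_nth p n * cnj u ^ n)) sums cnj (f (cnj u))" by (simp only: sums_cnj)
      then show ?case by (simp add: q_def)
    qed
  qed
  then have "(\<lambda>z. f z - cnj (f (cnj z))) has_fps_expansion p - q"
    unfolding f_def using p by (intro fps_expansion_intros eval_fps_has_fps_expansion)
  moreover have "{k. f (t k) \<in> \<real>} \<subseteq> {k. f (t k) - cnj (f (cnj (t k))) = 0}"
    using t(2) by (auto simp: Reals_cnj_iff)
  then have "infinite {k. f (t k) - cnj (f (cnj (t k))) = 0}"
    using real_values finite_subset f_def by blast
  ultimately have "p - q = 0" using fps_eq_0_if_zeros_accumulate[OF _ t(1)] by blast
  then have "fps_nth p k = cnj (fps_nth p k)" by (metis eq_iff_diff_eq_0 fps_nth_Abs_fps q_def)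
  then show ?thesis by (simp add: Reals_cnj_iff)
qed

text \<open>Divide N and all exponents by their greatest common divisor d and use t^d as the new
  parameter; p has no terms outside the multiples of d, so no value changes. For p = 0 this yields
  the normal form \<open>(1, 0)\<close>.\<close>

lemma puiseux_series_reduce:
  fixes p :: "complex fps"
  assumes N: "N > 0" and p: "fps_conv_radius p > 0" "\<And>k. k < N \<Longrightarrow> fps_nth p k = 0"
  obtains n d q where "N = n * d" "d > 0" "(n, q) \<in> puiseux_series" "\<forall>k. fps_nth q k = fps_nth p (d * k)"
    "\<forall>t. ereal (norm t) < fps_conv_radius p \<longrightarrow> eval_fps q (t ^ d) = eval_fps p t"
proof -
  define d where "d = Gcd (insert N {k. fps_nth p k \<noteq> 0})"
  define q where "q = Abs_fps (\<lambda>k. fps_nth p (d * k))"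
  have dvd: "d dvd N" "\<And>k. fps_nth p k \<noteq> 0 \<Longrightarrow> d dvd k"
    unfolding d_def by (rule Gcd_dvd; simp)+
  define n where "n = N div d"
  have N_eq: "N = n * d" using dvd by (simp add: n_def)
  have d: "d > 0" and n: "n > 0" using N N_eq by auto
  have sums: "(\<lambda>k. fps_nth q k * (t ^ d) ^ k) sums eval_fps p t" if "ereal (norm t) < fps_conv_radius p" for t
  proof -
    have "(\<lambda>k. fps_nth p (d * k) * t ^ (d * k)) sums eval_fps p t \<longleftrightarrow>
          (\<lambda>k. fps_nth p k * t ^ k) sums eval_fps p t"
      using d dvd(2) by (intro sums_mono_reindex[of "\<lambda>k. d * k"]) (auto simp: strict_mono_def image_iff dvd_def)
    then show ?thesis using sums_eval_fps[OF that] by (simp add: q_def power_mult)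
  qed
  have "fps_conv_radius q > 0"
  proof -
    obtain r where r: "r > 0" "ereal r < fps_conv_radius p"
      using p(1) ereal_dense2[of 0 "fps_conv_radius p"] by (auto simp: zero_ereal_def)
    have "summable (\<lambda>k. fps_nth q k * (of_real r ^ d) ^ k)"
      using sums[of "of_real r"] r by (auto simp: sums_iff)
    then have "fps_conv_radius q \<ge> norm (of_real r ^ d :: complex)"
      unfolding fps_conv_radius_def by (rule conv_radius_geI)
    moreover have "norm (of_real r ^ d :: complex) > 0" using r by simp
    ultimately show ?thesis by (metis ereal_less(2) order.strict_trans2)
  qed
  moreover have "Gcd (insert n {k. fps_nth q k \<noteq> 0}) = 1"
  proof -
    define e where "e = Gcd (insert n {k. fps_nth q k \<noteq> 0})"
    have e: "e dvd n" "\<And>k. fps_nth q k \<noteq> 0 \<Longrightarrow> e dvd k"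
      unfolding e_def by (rule Gcd_dvd; simp)+
    \<comment> \<open>A common divisor e left after the division would make d * e a common divisor
      of the original exponents, hence a divisor of d.\<close>
    have "d * e dvd d"
    proof (subst (2) d_def, rule Gcd_greatest)
      fix a assume "a \<in> insert N {k. fps_nth p k \<noteq> 0}"
      then consider "a = N" | "fps_nth p a \<noteq> 0" by blast
      then show "d * e dvd a"
      proof cases
        case 1
        then show ?thesis using e(1) by (simp add: N_eq mult.commute)
      next
        case 2
        then obtain k where k: "a = d * k" using dvd(2) by blast
        then show ?thesis using 2 e(2)[of k] by (simp add: q_def)
      qed
    qed
    then show ?thesis using d by (simp add: e_def)
  qed
  moreover have "n \<le> k" if "fps_nth q k \<noteq> 0" for k
  proof -
    have "\<not> d * k < N" using that p(2)[of "d * k"] by (auto simp: q_def)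
    then show ?thesis using d by (simp add: N_eq mult.commute)
  qed
  ultimately have "(n, q) \<in> puiseux_series" using n by (auto simp: puiseux_series_def)
  moreover have "eval_fps q (t ^ d) = eval_fps p t" if "ereal (norm t) < fps_conv_radius p" for t
    using sums[OF that] by (simp add: eval_fps_def sums_iff)
  ultimately show ?thesis using that[OF N_eq d] by (simp add: q_def)
qed

text \<open>The branch meets infinitely many real zeros of h at real parameters. The identity
  theorem turns this into h = 0 along the whole branch, and reflection makes its coefficients
  real.\<close>

proposition real_puiseux_root_through_sequence:
  fixes h :: "real poly poly" and x y :: "nat \<Rightarrow> real"
  assumes h: "h \<noteq> 0" "\<And>k. poly2 h (x k) (y k) = 0"
    and x: "\<And>k. x k > 0" "x \<longlonglongrightarrow> 0"
    and y: "\<And>k. \<bar>y k\<bar> \<le> C * x k"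
  obtains n q where "(n, q) \<in> newton_puiseux_roots h" "real_puiseux (n, q)"
    "filterlim (\<lambda>k. complex_of_real (root n (x k))) (at 0) sequentially"
    "infinite {k. eval_fps q (of_real (root n (x k))) = of_real (y k)}"
proof -
  have root_lim: "filterlim (\<lambda>k. complex_of_real (root n (x k))) (at 0) sequentially" if "n > 0" for n
  proof -
    have "(\<lambda>k. root n (x k)) \<longlonglongrightarrow> root n 0" by (intro tendsto_intros x)
    then show ?thesis
      using that x(1) tendsto_of_real[of "\<lambda>k. root n (x k)" 0 sequentially, where 'a = complex]
      by (auto simp: filterlim_at less_imp_neq[THEN not_sym])
  qed
  have "complexify h \<noteq> 0" using h(1) by (simp add: complexify_eq_0_iff)
  moreover have "eval2 (complexify h) (of_real (x k)) (of_real (y k)) = 0" for k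
    using h(2) by (simp add: eval2_complexify)
  moreover have "norm (complex_of_real (y k)) \<le> C * x k" for k using y by simp
  ultimately obtain N p where N: "N > 0" and p: "fps_conv_radius p > 0" "\<And>k. k < N \<Longrightarrow> fps_nth p k = 0"
    and py: "infinite {k. eval_fps p (of_real (root N (x k))) = complex_of_real (y k)}"
    by (rule complex_puiseux_parametrization[OF _ _ x]) blast
  define t where "t k = complex_of_real (root N (x k))" for k
  have t: "filterlim t (at 0) sequentially" unfolding t_def by (rule root_lim[OF N])
  have "{k. eval_fps p (t k) = complex_of_real (y k)} \<subseteq> {k. eval_fps p (t k) \<in> \<real>}" by auto
  then have "infinite {k. eval_fps p (t k) \<in> \<real>}" using py finite_subset unfolding t_def by blast
  then have p_real: "fps_nth p k \<in> \<real>" for k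
    by (intro fps_coeffs_real_if_real_values[OF p(1) t]) (auto simp: t_def)
  obtain n d q where n: "N = n * d" "d > 0" and q: "(n, q) \<in> puiseux_series" "\<forall>k. fps_nth q k = fps_nth p (d * k)"
    "\<forall>t. ereal (norm t) < fps_conv_radius p \<longrightarrow> eval_fps q (t ^ d) = eval_fps p t"
    by (rule puiseux_series_reduce[OF N p])
  have n0: "n > 0" and q_conv: "fps_conv_radius q > 0" using q(1) by (auto simp: puiseux_series_def)
  have t_pow: "t k ^ d = of_real (root n (x k))" for k
  proof -
    have "root N (x k) = root d (root n (x k))"
      using n by (simp add: real_root_mult_exp mult.commute)
    then show ?thesis using n(2) n0 x(1)[of k] by (simp add: t_def real_root_pow_pos2 less_imp_le flip: of_real_power)
  qed
  have "\<forall>\<^sub>F z in at 0. ereal (norm (z::complex)) < fps_conv_radius p"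
    using p(1) eventually_nhds_in_open[of "eball 0 (fps_conv_radius p)" "0::complex"]
    by (auto simp: eventually_at_filter in_eball_iff zero_ereal_def elim: eventually_mono)
  then have "\<forall>\<^sub>F k in sequentially. ereal (norm (t k)) < fps_conv_radius p"
    using t by (rule eventually_compose_filterlim)
  then have "finite {k. \<not> ereal (norm (t k)) < fps_conv_radius p}"
    by (simp add: eventually_cofinite flip: cofinite_eq_sequentially)
  then have "infinite ({k. eval_fps p (t k) = of_real (y k)} - {k. \<not> ereal (norm (t k)) < fps_conv_radius p})"
    using py by (simp add: t_def)
  moreover have "{k. eval_fps p (t k) = of_real (y k)} - {k. \<not> ereal (norm (t k)) < fps_conv_radius p}
      \<subseteq> {k. eval_fps q (of_real (root n (x k))) = of_real (y k)}"
    using q(3) t_pow by auto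
  ultimately have qy: "infinite {k. eval_fps q (of_real (root n (x k))) = of_real (y k)}"
    using finite_subset by blast
  have "{k. eval_fps q (of_real (root n (x k))) = of_real (y k)} \<subseteq>
      {k. eval2 (complexify h) (of_real (root n (x k)) ^ n) (eval_fps q (of_real (root n (x k)))) = 0}"
  proof safe
    fix k assume k: "eval_fps q (of_real (root n (x k))) = of_real (y k)"
    have "complex_of_real (root n (x k)) ^ n = of_real (x k)"
      using n0 x(1)[of k] by (simp add: real_root_pow_pos2 less_imp_le flip: of_real_power)
    then show "eval2 (complexify h) (of_real (root n (x k)) ^ n) (eval_fps q (of_real (root n (x k)))) = 0"
      using h(2)[of k] by (simp add: k eval2_complexify)
  qed
  then have "infinite {k. eval2 (complexify h) (of_real (root n (x k)) ^ n) (eval_fps q (of_real (root n (x k)))) = 0}"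
    using qy finite_subset by blast
  then have "puiseux_subst h (n, q) = 0"
    by (rule fps_eq_0_if_zeros_accumulate[OF puiseux_subst_has_fps_expansion[OF q_conv] root_lim[OF n0]])
  then have "(n, q) \<in> newton_puiseux_roots h" using q(1) by (simp add: newton_puiseux_roots_def)
  moreover have "real_puiseux (n, q)" using p_real q(2) by (simp add: real_puiseux_def)
  ultimately show ?thesis using that root_lim[OF n0] qy by blast
qed

section \<open>Real zeros and critical points on level sets\<close>

lemma coeff_hom_component:
  "coeff (coeff (hom_component h m) j) i = (if i + j = m then coeff (coeff h j) i else 0)"
proof -
  have "coeff (hom_component h m) j =
      (\<Sum>l\<le>m. if l = j then monom (coeff (coeff h l) (m - l)) (m - l) else 0)"
    unfolding hom_component_def coeff_sum by (intro sum.cong) auto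
  also have "\<dots> = (if j \<le> m then monom (coeff (coeff h j) (m - j)) (m - j) else 0)"
    by (simp add: sum.delta')
  finally show ?thesis by auto
qed

lemma poly2_altdef:
  assumes "degree h \<le> J" "\<And>j. degree (coeff h j) \<le> I"
  shows "poly2 h a b = (\<Sum>j\<le>J. \<Sum>i\<le>I. coeff (coeff h j) i * a ^ i * b ^ j)"
proof -
  have coeff_eq: "poly (coeff h j) a = (\<Sum>i\<le>I. coeff (coeff h j) i * a ^ i)" for j
    unfolding poly_altdef by (rule sum.mono_neutral_left) (use assms(2)[of j] in \<open>auto simp: coeff_eq_0\<close>)
  have "poly2 h a b = (\<Sum>j\<le>degree h. poly (coeff h j) a * b ^ j)"
    by (simp add: poly2_eq_eval2 eval2_eq_sum)
  also have "\<dots> = (\<Sum>j\<le>J. poly (coeff h j) a * b ^ j)"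
    by (rule sum.mono_neutral_left) (use assms in \<open>auto simp: coeff_eq_0\<close>)
  finally show ?thesis by (simp add: coeff_eq sum_distrib_right)
qed

lemma y_regular_coeffs:
  assumes "y_regular h"
  shows "coeff (coeff h (ord2 h)) 0 \<noteq> 0" and "i + j < ord2 h \<Longrightarrow> coeff (coeff h j) i = 0"
proof -
  define m where "m = ord2 h"
  define H where "H = hom_component h m"
  have "poly2 H 0 1 = (\<Sum>j\<le>m. \<Sum>i\<le>m. coeff (coeff H j) i * 0 ^ i * 1 ^ j)"
    by (intro poly2_altdef degree_le) (auto simp: H_def coeff_hom_component poly_eq_iff)
  also have "\<dots> = (\<Sum>j\<le>m. coeff (coeff H j) 0)"
  proof (intro sum.cong refl)
    fix j
    show "(\<Sum>i\<le>m. coeff (coeff H j) i * 0 ^ i * 1 ^ j) = coeff (coeff H j) 0"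
      by (subst sum.mono_neutral_right[of _ "{0}"]) auto
  qed
  also have "\<dots> = coeff (coeff h m) 0"
    by (simp add: H_def coeff_hom_component sum.delta)
  finally show "coeff (coeff h (ord2 h)) 0 \<noteq> 0"
    using assms by (simp add: y_regular_def H_def m_def)
  show "coeff (coeff h j) i = 0" if "i + j < ord2 h"
  proof -
    have "hom_component h (i + j) = 0"
      using that not_less_Least unfolding ord2_def by blast
    then show ?thesis using coeff_hom_component[of h "i + j" j i] by simp
  qed
qed

text \<open>In the cone |a| <= \<eta> |b| the term in b^m dominates all others, so h has no zero
  there with 0 < |b| < \<eta>; outside the cone the linear bound holds with C = 1/\<eta>.\<close>

lemma y_regular_zero_bound:
  assumes "y_regular h"
  obtains r C where "r > 0" "\<And>a b. \<bar>b\<bar> < r \<Longrightarrow> poly2 h a b = 0 \<Longrightarrow> \<bar>b\<bar> \<le> C * \<bar>a\<bar>"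
proof -
  define m where "m = ord2 h"
  define J where "J = degree h"
  define I where "I = (\<Sum>j\<le>J. degree (coeff h j))"
  define c where "c j i = coeff (coeff h j) i" for j i
  have I: "degree (coeff h j) \<le> I" for j
  proof (cases "j \<le> J")
    case True
    then show ?thesis unfolding I_def by (intro member_le_sum) auto
  qed (simp add: J_def coeff_eq_0)
  have cm: "c m 0 \<noteq> 0" and c_low: "\<And>i j. i + j < m \<Longrightarrow> c j i = 0"
    using y_regular_coeffs[OF assms] by (auto simp: c_def m_def)
  have mJ: "m \<le> J" using cm by (auto simp: c_def J_def intro!: le_degree)
  define S where "S = ({..J} \<times> {..I}) - {(m, 0)}"
  define K where "K = (\<Sum>(j, i)\<in>S. \<bar>c j i\<bar>)"
  have K: "K \<ge> 0" unfolding K_def by (intro sum_nonneg) auto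
  \<comment> \<open>K + 1 instead of K avoids division by zero and makes \<eta> K strictly smaller
    than the coefficient of y^m.\<close>
  define \<eta> where "\<eta> = min 1 (\<bar>c m 0\<bar> / (K + 1))"
  have eta: "\<eta> > 0" "\<eta> \<le> 1" using cm K by (auto simp: \<eta>_def)
  have "\<eta> * (K + 1) \<le> \<bar>c m 0\<bar>" using K by (simp add: \<eta>_def flip: pos_le_divide_eq)
  then have eta_K: "\<eta> * K < \<bar>c m 0\<bar>" using eta(1) by (simp add: algebra_simps)
  have "\<eta> * \<bar>b\<bar> \<le> \<bar>a\<bar>" if b: "\<bar>b\<bar> < \<eta>" and zero: "poly2 h a b = 0" for a b
  proof (rule ccontr)
    assume "\<not> \<eta> * \<bar>b\<bar> \<le> \<bar>a\<bar>"
    then have a: "\<bar>a\<bar> \<le> \<eta> * \<bar>b\<bar>" and b0: "b \<noteq> 0" by (auto simp: not_le)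
    have b1: "\<bar>b\<bar> \<le> 1" using b eta by simp
    have term_le: "\<bar>c j i * a ^ i * b ^ j\<bar> \<le> \<bar>c j i\<bar> * (\<eta> * \<bar>b\<bar> ^ m)" if ji: "(j, i) \<in> S" for j i
    proof (cases "i + j < m")
      case True
      then show ?thesis by (simp add: c_low)
    next
      case False
      \<comment> \<open>The gain \<eta> comes from a surplus factor |b| < \<eta> in a pure power of
        b, and from the cone condition when a occurs.\<close>
      have "\<bar>a\<bar> ^ i * \<bar>b\<bar> ^ j \<le> \<eta> * \<bar>b\<bar> ^ m"
      proof (cases "i = 0")
        case True
        then have "j > m" using False ji by (auto simp: S_def)
        then have "\<bar>b\<bar> ^ j \<le> \<bar>b\<bar> ^ Suc m" using b1 by (intro power_decreasing) auto
        also have "\<dots> \<le> \<eta> * \<bar>b\<bar> ^ m" using b by (simp add: mult_right_mono)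
        finally show ?thesis using True by simp
      next
        case i: False
        have "\<bar>a\<bar> ^ i \<le> \<eta> ^ i * \<bar>b\<bar> ^ i"
          using power_mono[OF a, of i] by (simp add: power_mult_distrib)
        also have "\<dots> \<le> \<eta> * \<bar>b\<bar> ^ i"
          using power_decreasing[of 1 i \<eta>] i eta by (intro mult_right_mono) auto
        finally have "\<bar>a\<bar> ^ i * \<bar>b\<bar> ^ j \<le> \<eta> * \<bar>b\<bar> ^ i * \<bar>b\<bar> ^ j" by (intro mult_right_mono) auto
        also have "\<dots> = \<eta> * \<bar>b\<bar> ^ (i + j)" by (simp add: power_add)
        also have "\<dots> \<le> \<eta> * \<bar>b\<bar> ^ m" using False b1 eta by (intro mult_left_mono power_decreasing) auto
        finally show ?thesis .
      qed
      then show ?thesis by (simp add: abs_mult power_abs mult.assoc mult_left_mono)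
    qed
    have "poly2 h a b = (\<Sum>(j, i)\<in>{..J} \<times> {..I}. c j i * a ^ i * b ^ j)"
      unfolding c_def by (subst poly2_altdef[of h J I]) (auto simp: J_def I sum.cartesian_product)
    also have "\<dots> = c m 0 * b ^ m + (\<Sum>(j, i)\<in>S. c j i * a ^ i * b ^ j)"
      unfolding S_def using mJ by (subst sum.remove[of _ "(m, 0)"]) auto
    finally have "c m 0 * b ^ m = - (\<Sum>(j, i)\<in>S. c j i * a ^ i * b ^ j)"
      using zero by simp
    then have "\<bar>c m 0\<bar> * \<bar>b\<bar> ^ m = \<bar>\<Sum>(j, i)\<in>S. c j i * a ^ i * b ^ j\<bar>"
      by (simp flip: abs_mult power_abs)
    also have "\<dots> \<le> (\<Sum>(j, i)\<in>S. \<bar>c j i\<bar> * (\<eta> * \<bar>b\<bar> ^ m))"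
      by (intro order.trans[OF sum_abs] sum_mono) (use term_le in auto)
    also have "\<dots> = \<eta> * K * \<bar>b\<bar> ^ m"
      by (simp add: K_def sum_distrib_left sum_distrib_right case_prod_unfold mult_ac)
    finally have "\<bar>c m 0\<bar> \<le> \<eta> * K" using b0 by simp
    then show False using eta_K by simp
  qed
  then have "\<bar>b\<bar> \<le> (1 / \<eta>) * \<bar>a\<bar>" if "\<bar>b\<bar> < \<eta>" "poly2 h a b = 0" for a b
    using that eta(1) by (simp add: field_simps)
  then show ?thesis by (rule that[OF eta(1)])
qed

section \<open>Critical points of f on level sets of g\<close>

definition pair_eval :: "real poly poly \<Rightarrow> real \<times> real \<Rightarrow> real" where
  "pair_eval h P = poly2 h (fst P) (snd P)"

lemma pair_eval_has_derivative:
  "(pair_eval h has_derivative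
     (\<lambda>v. pair_eval (pderiv_x h) P * fst v + pair_eval (pderiv_y h) P * snd v)) (at P)"
proof (induction h)
  case 0
  then show ?case by (simp add: pair_eval_def[abs_def] poly2_def pderiv_x_def pderiv_y_def)
next
  case (pCons q h)
  have eq: "pair_eval (pCons q h) = (\<lambda>P. poly q (fst P) + snd P * pair_eval h P)" for q h
    by (rule ext) (simp add: pair_eval_def poly2_eq_eval2 eval2_pCons)
  have x: "pderiv_x (pCons q h) = pCons (pderiv q) (pderiv_x h)"
    by (simp add: pderiv_x_def map_poly_pCons)
  have y: "pair_eval (pderiv_y (pCons q h)) P = pair_eval h P + snd P * pair_eval (pderiv_y h) P"
    by (simp add: pderiv_y_def pderiv_pCons pair_eval_def poly2_def)
  have "((\<lambda>P. poly q (fst P)) has_derivative (\<lambda>v. fst v * poly (pderiv q) (fst P))) (at P)"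
    by (rule has_derivative_compose[of fst fst, OF _ poly_DERIV[unfolded has_field_derivative_def], THEN has_derivative_eq_rhs])
       (auto intro!: derivative_eq_intros)
  then show ?case
    unfolding eq x y
    by (auto intro!: derivative_eq_intros pCons simp: algebra_simps)
qed

lemma continuous_on_pair_eval: "continuous_on A (pair_eval h)"
  by (intro continuous_at_imp_continuous_on ballI has_derivative_continuous[OF pair_eval_has_derivative])

text \<open>At a point with nonzero Jacobian the derivative of (f, g) has the right inverse E given
  by Cramer's rule, which is all that the open mapping theorem for maps differentiable at a point
  asks for.\<close>

lemma pair_eval_local_surjection:
  assumes "pair_eval (jacobian2 f g) P \<noteq> 0" "open U" "P \<in> U"
  shows "(pair_eval f P, pair_eval g P) \<in> interior ((\<lambda>Q. (pair_eval f Q, pair_eval g Q)) ` U)"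
proof -
  define fx fy gx gy where "fx = pair_eval (pderiv_x f) P" and "fy = pair_eval (pderiv_y f) P"
    and "gx = pair_eval (pderiv_x g) P" and "gy = pair_eval (pderiv_y g) P"
  define J where "J = fx * gy - fy * gx"
  have J: "J \<noteq> 0"
    using assms(1) by (simp add: J_def jacobian2_def pair_eval_def poly2_def fx_def fy_def gx_def gy_def)
  define D where "D v = (fx * fst v + fy * snd v, gx * fst v + gy * snd v)" for v
  define E where "E w = ((gy * fst w - fy * snd w) / J, (fx * snd w - gx * fst w) / J)" for w
  have "((\<lambda>Q. (pair_eval f Q, pair_eval g Q)) has_derivative D) (at P)"
    unfolding D_def fx_def fy_def gx_def gy_def
    by (intro has_derivative_Pair pair_eval_has_derivative)
  moreover have "bounded_linear E"
    unfolding E_def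
    by (intro bounded_linear_Pair; unfold linear_conv_bounded_linear[symmetric]; intro linearI)
       (auto simp: algebra_simps add_divide_distrib diff_divide_distrib)
  moreover have "D \<circ> E = id"
  proof (rule ext)
    fix w
    have "fx * (gy * fst w - fy * snd w) + fy * (fx * snd w - gx * fst w) = J * fst w"
      by (simp add: J_def algebra_simps)
    then have "fx * ((gy * fst w - fy * snd w) / J) + fy * ((fx * snd w - gx * fst w) / J) = fst w"
      using J by (simp flip: add_divide_distrib)
    moreover have "gx * (gy * fst w - fy * snd w) + gy * (fx * snd w - gx * fst w) = J * snd w"
      by (simp add: J_def algebra_simps)
    then have "gx * ((gy * fst w - fy * snd w) / J) + gy * ((fx * snd w - gx * fst w) / J) = snd w"
      using J by (simp flip: add_divide_distrib)
    ultimately show "(D \<circ> E) w = id w" by (simp add: D_def E_def)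
  qed
  ultimately show ?thesis
    using assms
    by (intro sussmann_open_mapping[where S = U and f' = D and g' = E]
          continuous_on_Pair continuous_on_pair_eval) (auto simp: interior_open)
qed

text \<open>
  Lagrange multipliers: at an interior maximum of \<open>\<bar>f\<bar>\<close> on a level set of \<open>g\<close> the Jacobian vanishes.
\<close>
lemma jacobian_zero_on_level_set:
  assumes "P \<in> cball 0 r" "pair_eval f P \<noteq> 0"
    and sphere: "\<And>Q. Q \<in> sphere 0 r \<Longrightarrow> pair_eval g Q \<noteq> pair_eval g P"
  obtains Q where "Q \<in> ball 0 r" "pair_eval g Q = pair_eval g P" "\<bar>pair_eval f P\<bar> \<le> \<bar>pair_eval f Q\<bar>"
    "pair_eval (jacobian2 f g) Q = 0"
proof -
  define K where "K = cball 0 r \<inter> pair_eval g -` {pair_eval g P}"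
  have "closed K"
    unfolding K_def by (intro continuous_closed_preimage continuous_on_pair_eval) auto
  then have "compact K"
    by (rule bounded_closed_imp_seq_compact[unfolded compact_eq_seq_compact_metric[symmetric], rotated])
       (auto simp: K_def)
  moreover have "P \<in> K" using assms by (simp add: K_def)
  then have "K \<noteq> {}" by blast
  ultimately obtain Q where Q: "Q \<in> K" "\<And>R. R \<in> K \<Longrightarrow> \<bar>pair_eval f R\<bar> \<le> \<bar>pair_eval f Q\<bar>"
    using continuous_attains_sup[of K "\<lambda>R. \<bar>pair_eval f R\<bar>"]
      continuous_on_rabs[OF continuous_on_pair_eval] by blast
  have Qball: "Q \<in> ball 0 r" using Q(1) sphere[of Q] by (auto simp: K_def less_le)
  have fQ: "\<bar>pair_eval f Q\<bar> > 0" using Q(2)[OF \<open>P \<in> K\<close>] assms(2) by auto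
  have "pair_eval (jacobian2 f g) Q = 0"
  proof (rule ccontr)
    assume "pair_eval (jacobian2 f g) Q \<noteq> 0"
    from pair_eval_local_surjection[OF this open_ball Qball]
    obtain e where e: "e > 0" "ball (pair_eval f Q, pair_eval g Q) e \<subseteq> (\<lambda>Q. (pair_eval f Q, pair_eval g Q)) ` ball 0 r"
      unfolding mem_interior by blast
    \<comment> \<open>Moving the value of f away from 0 with g fixed stays in the image of the ball,
      so some point of the level set beats the maximum.\<close>
    define z where "z = pair_eval f Q + sgn (pair_eval f Q) * (e / 2)"
    have "dist (pair_eval f Q) z = e / 2"
      using fQ e(1) by (simp add: z_def dist_real_def abs_mult)
    then have "(z, pair_eval g Q) \<in> ball (pair_eval f Q, pair_eval g Q) e"
      using e(1) by (simp add: dist_Pair_Pair)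
    with e(2) have "(z, pair_eval g Q) \<in> (\<lambda>Q. (pair_eval f Q, pair_eval g Q)) ` ball 0 r" by (rule subsetD)
    then obtain R where R: "R \<in> ball 0 r" "pair_eval f R = z" "pair_eval g R = pair_eval g Q"
      by (metis (mono_tags, lifting) imageE Pair_inject)
    then have "R \<in> K" using Q(1) by (simp add: K_def)
    moreover have "\<bar>z\<bar> = \<bar>pair_eval f Q\<bar> + e / 2"
      using fQ e(1) by (auto simp: z_def sgn_if)
    ultimately show False using Q(2)[of R] R(2) e(1) by simp
  qed
  then show ?thesis using that Qball Q \<open>P \<in> K\<close> by (simp add: K_def)
qed

text \<open>On the closed annulus between \<rho> and r, |g| has a positive minimum. A bad point P so
  close to 0 that |g P| is below it has a level set that misses the annulus, so the maximiser of |f|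
  on it lies within \<rho> of the origin, with the same g and no smaller |f|.\<close>

lemma critical_sequence_if_not_tendsto:
  assumes g0: "pair_eval g 0 = 0" and iso: "\<forall>\<^sub>F P in at 0. pair_eval g P \<noteq> 0"
    and not_lim: "\<not> ((\<lambda>P. pair_eval f P / pair_eval g P) \<longlongrightarrow> 0) (at 0 within {P. pair_eval g P \<noteq> 0})"
  obtains \<epsilon> Q where "\<epsilon> > 0" "Q \<longlonglongrightarrow> 0" "\<And>k. pair_eval g (Q k) \<noteq> 0" "\<And>k. pair_eval (jacobian2 f g) (Q k) = 0"
    "\<And>k. \<epsilon> * \<bar>pair_eval g (Q k)\<bar> \<le> \<bar>pair_eval f (Q k)\<bar>"
proof -
  obtain r0 where r0: "r0 > 0" "\<And>P. P \<noteq> 0 \<Longrightarrow> dist P 0 < r0 \<Longrightarrow> pair_eval g P \<noteq> 0"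
    using iso unfolding eventually_at by auto
  define r where "r = r0 / 2"
  have r: "r > 0" "\<And>P. P \<noteq> 0 \<Longrightarrow> norm P \<le> r \<Longrightarrow> pair_eval g P \<noteq> 0" using r0 by (auto simp: r_def)
  obtain \<epsilon> where \<epsilon>: "\<epsilon> > 0"
    "\<not> (\<exists>d>0. \<forall>P\<in>{P. pair_eval g P \<noteq> 0}. 0 < dist P 0 \<and> dist P 0 < d \<longrightarrow>
        dist (pair_eval f P / pair_eval g P) 0 < \<epsilon>)"
    using not_lim unfolding Lim_within by blast
  have large: "\<exists>P. pair_eval g P \<noteq> 0 \<and> norm P < d \<and> \<epsilon> \<le> \<bar>pair_eval f P / pair_eval g P\<bar>" if d: "d > 0" for d
  proof -
    obtain P where "pair_eval g P \<noteq> 0" "dist P 0 < d" "\<not> dist (pair_eval f P / pair_eval g P) 0 < \<epsilon>"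
      using \<epsilon>(2) d by blast
    then show ?thesis by (intro exI[of _ P]) (simp add: not_less)
  qed
  have near: "\<exists>Q. norm Q < \<rho> \<and> pair_eval g Q \<noteq> 0 \<and> pair_eval (jacobian2 f g) Q = 0 \<and>
          \<epsilon> * \<bar>pair_eval g Q\<bar> \<le> \<bar>pair_eval f Q\<bar>" if \<rho>: "\<rho> > 0" "\<rho> \<le> r" for \<rho>
  proof -
    define A where "A = cball 0 r - ball (0 :: real \<times> real) \<rho>"
    have "compact A" unfolding A_def by (intro compact_diff) auto
    moreover have "(r, 0) \<in> A" using \<rho> by (simp add: A_def norm_Pair)
    then have "A \<noteq> {}" by blast
    ultimately obtain M where M: "M \<in> A" "\<And>R. R \<in> A \<Longrightarrow> \<bar>pair_eval g M\<bar> \<le> \<bar>pair_eval g R\<bar>"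
      using continuous_attains_inf[of A "\<lambda>R. \<bar>pair_eval g R\<bar>"]
        continuous_on_rabs[OF continuous_on_pair_eval] by blast
    have "M \<noteq> 0" "norm M \<le> r" using M(1) \<rho> by (auto simp: A_def)
    then have pos: "\<bar>pair_eval g M\<bar> > 0" using r(2) by simp
    have "isCont (pair_eval g) 0"
      by (rule has_derivative_continuous[OF pair_eval_has_derivative])
    then obtain d where d: "d > 0" "\<forall>P. dist P 0 < d \<longrightarrow> dist (pair_eval g P) (pair_eval g 0) < \<bar>pair_eval g M\<bar>"
      unfolding continuous_at_eps_delta using pos by blast
    have "min d r > 0" using d(1) r(1) by simp
    from large[OF this]
    obtain P where P: "pair_eval g P \<noteq> 0" "norm P < min d r" "\<epsilon> \<le> \<bar>pair_eval f P / pair_eval g P\<bar>"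
      by blast
    have P_le: "\<epsilon> * \<bar>pair_eval g P\<bar> \<le> \<bar>pair_eval f P\<bar>"
      using P(1,3) by (simp add: abs_divide pos_le_divide_eq)
    moreover have "\<epsilon> * \<bar>pair_eval g P\<bar> > 0" using \<epsilon>(1) P(1) by simp
    ultimately have "pair_eval f P \<noteq> 0" by auto
    have small: "R \<notin> A" if "pair_eval g R = pair_eval g P" for R
      using M(2)[of R] d(2)[rule_format, of P] P(2) that g0 by (auto simp: dist_real_def)
    obtain Q where Q: "Q \<in> ball 0 r" "pair_eval g Q = pair_eval g P" "\<bar>pair_eval f P\<bar> \<le> \<bar>pair_eval f Q\<bar>"
      "pair_eval (jacobian2 f g) Q = 0"
    proof (rule jacobian_zero_on_level_set[of P r f g])
      show "P \<in> cball 0 r" using P(2) by simp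
      show "pair_eval g R \<noteq> pair_eval g P" if "R \<in> sphere 0 r" for R
        using small[of R] that \<rho> by (auto simp: A_def)
      show "pair_eval f P \<noteq> 0" by fact
    qed
    have "norm Q < \<rho>" using small[OF Q(2)] Q(1) by (simp add: A_def)
    then show ?thesis using Q P(1) P_le by (intro exI[of _ Q]) auto
  qed
  define \<rho> where "\<rho> k = min r (1 / real (Suc k))" for k
  have "\<exists>Q. norm Q < \<rho> k \<and> pair_eval g Q \<noteq> 0 \<and> pair_eval (jacobian2 f g) Q = 0 \<and>
          \<epsilon> * \<bar>pair_eval g Q\<bar> \<le> \<bar>pair_eval f Q\<bar>" for k
    by (rule near) (use r(1) in \<open>auto simp: \<rho>_def\<close>)
  then obtain Q where Q: "\<And>k. norm (Q k) < \<rho> k" "\<And>k. pair_eval g (Q k) \<noteq> 0"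
    "\<And>k. pair_eval (jacobian2 f g) (Q k) = 0" "\<And>k. \<epsilon> * \<bar>pair_eval g (Q k)\<bar> \<le> \<bar>pair_eval f (Q k)\<bar>"
    by metis
  have "Q \<longlonglongrightarrow> 0"
  proof (rule Lim_null_comparison)
    show "(\<lambda>k. 1 / real (Suc k)) \<longlonglongrightarrow> 0" using LIMSEQ_inverse_real_of_nat by (simp add: inverse_eq_divide)
    show "\<forall>\<^sub>F k in sequentially. norm (Q k) \<le> 1 / real (Suc k)"
      using Q(1) by (intro always_eventually allI) (simp add: \<rho>_def less_imp_le)
  qed
  then show ?thesis using that \<epsilon>(1) Q by blast
qed

section \<open>Limits and orders along branches\<close>

lemma eval2_complexify_scale_x:
  assumes "eval_fps q (of_real t) = of_real b"
  shows "eval2 (complexify (scale_x s h)) (of_real t ^ n) (eval_fps q (of_real t)) =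
    of_real (poly2 h (s * t ^ n) b)"
  unfolding assms of_real_power[symmetric] eval2_complexify poly2_scale_x ..

lemma fps_nonzero_if_values_nonzero:
  fixes f :: "complex \<Rightarrow> complex"
  assumes "f has_fps_expansion F" "filterlim t (at 0) sequentially" "infinite {k. f (t k) \<noteq> 0}"
  shows "F \<noteq> 0"
proof
  assume "F = 0"
  then have "\<forall>\<^sub>F z in nhds 0. f z = 0" using assms(1) has_fps_expansion_0_iff by blast
  then have "\<forall>\<^sub>F z in at 0. f z = 0" by (auto simp: eventually_at_filter elim: eventually_mono)
  then have "\<forall>\<^sub>F k in sequentially. f (t k) = 0" using assms(2) by (rule eventually_compose_filterlim)
  then show False using assms(3) by (simp add: eventually_cofinite flip: cofinite_eq_sequentially)
qed

lemma eval_fps_real: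
  assumes "\<And>k. fps_nth q k \<in> \<real>" "ereal (norm (of_real t :: complex)) < fps_conv_radius q"
  shows "eval_fps q (of_real t :: complex) \<in> \<real>"
proof -
  have "(\<lambda>k. fps_nth q k * of_real t ^ k) sums eval_fps q (of_real t)"
    using assms(2) by (rule sums_eval_fps)
  then have "(\<lambda>k. cnj (fps_nth q k * of_real t ^ k)) sums cnj (eval_fps q (of_real t))"
    by (simp only: sums_cnj)
  moreover have "cnj (fps_nth q k) = fps_nth q k" for k using assms(1) by (simp add: Reals_cnj_iff)
  ultimately have "(\<lambda>k. fps_nth q k * of_real t ^ k) sums cnj (eval_fps q (of_real t))" by simp
  then have "cnj (eval_fps q (of_real t)) = eval_fps q (of_real t)"
    using \<open>(\<lambda>k. fps_nth q k * of_real t ^ k) sums eval_fps q (of_real t)\<close> sums_unique2 by blast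
  then show ?thesis by (simp add: Reals_cnj_iff)
qed

text \<open>Sample the branch at the real parameters 1/(k+1). If f had order at most that of g, then
  g/f would have a finite limit along the branch, and its product with f/g, constantly 1 in the end,
  would tend to 0.\<close>

lemma ord_subst_less_if_ratio_tendsto_0:
  assumes \<gamma>: "\<gamma> \<in> puiseux_series" "real_puiseux \<gamma>" and s: "s \<noteq> 0"
    and f: "puiseux_subst (scale_x s f) \<gamma> \<noteq> 0"
    and g0: "pair_eval g 0 = 0" and iso: "\<forall>\<^sub>F P in at 0. pair_eval g P \<noteq> 0"
    and lim: "((\<lambda>P. pair_eval f P / pair_eval g P) \<longlongrightarrow> 0) (at 0 within {P. pair_eval g P \<noteq> 0})"
  shows "ord_subst (scale_x s f) \<gamma> > ord_subst (scale_x s g) \<gamma>"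
proof -
  obtain n q where \<gamma>_eq: "\<gamma> = (n, q)" by (cases \<gamma>)
  have n: "n > 0" and q: "fps_conv_radius q > 0" "fps_nth q 0 = 0" "\<And>k. fps_nth q k \<in> \<real>"
    using \<gamma> unfolding \<gamma>_eq puiseux_series_def real_puiseux_def by fastforce+
  define \<Phi> where "\<Phi> h t = eval2 (complexify (scale_x s h)) (t ^ n) (eval_fps q t)" for h t
  define S where "S h = puiseux_subst (scale_x s h) \<gamma>" for h
  have \<Phi>: "\<Phi> h has_fps_expansion S h" for h
    unfolding \<Phi>_def S_def \<gamma>_eq by (rule puiseux_subst_has_fps_expansion[OF q(1)])
  define t where "t k = 1 / real (Suc k)" for k
  have t_pos: "t k > 0" for k by (simp add: t_def)
  have t0: "t \<longlonglongrightarrow> 0" using LIMSEQ_inverse_real_of_nat by (simp add: t_def[abs_def] inverse_eq_divide)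
  define T where "T k = complex_of_real (t k)" for k
  have T: "filterlim T (at 0) sequentially"
    using t_pos tendsto_of_real[OF t0, where 'a = complex]
    by (auto simp: filterlim_at T_def[abs_def] less_imp_neq[THEN not_sym])
  have ev_T: "\<forall>\<^sub>F k in sequentially. A (T k)" if "\<forall>\<^sub>F z in at 0. A z" for A
    using that T by (rule eventually_compose_filterlim)
  \<comment> \<open>Taking the real part changes nothing once \<open>T k\<close> lies in the disc of
    convergence, where the value is already real.\<close>
  define b where "b k = Re (eval_fps q (T k))" for k
  define P where "P k = (s * t k ^ n, b k)" for k
  have "\<forall>\<^sub>F z in at 0. ereal (norm (z::complex)) < fps_conv_radius q"
    using q(1) eventually_nhds_in_open[of "eball 0 (fps_conv_radius q)" "0::complex"]
    by (auto simp: eventually_at_filter in_eball_iff zero_ereal_def elim: eventually_mono)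
  from ev_T[OF this] have "\<forall>\<^sub>F k in sequentially. eval_fps q (T k) = of_real (b k)"
  proof eventually_elim
    case (elim k)
    then have "eval_fps q (T k) \<in> \<real>" unfolding T_def using eval_fps_real q(3) by blast
    then show ?case by (auto simp: b_def elim: Reals_cases)
  qed
  then have \<Phi>P: "\<forall>\<^sub>F k in sequentially. \<Phi> h (T k) = of_real (pair_eval h (P k))" for h
  proof eventually_elim
    case (elim k)
    then show ?case using eval2_complexify_scale_x[of q "t k" "b k"]
      by (simp add: \<Phi>_def T_def P_def pair_eval_def)
  qed
  have "(eval_fps q \<longlongrightarrow> 0) (nhds 0)"
    using has_fps_expansion_imp_tendsto_0[OF eval_fps_has_fps_expansion[OF q(1)]] q(2) by simp
  then have "(eval_fps q \<longlongrightarrow> 0) (at 0)" by (rule tendsto_mono[rotated]) (simp add: at_within_def)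
  then have "(\<lambda>k. eval_fps q (T k)) \<longlonglongrightarrow> 0" using T by (rule filterlim_compose)
  then have "(\<lambda>k. b k) \<longlonglongrightarrow> 0" unfolding b_def using tendsto_Re by fastforce
  moreover have "(\<lambda>k. s * t k ^ n) \<longlonglongrightarrow> s * 0 ^ n" by (intro tendsto_intros t0)
  ultimately have "P \<longlonglongrightarrow> (0, 0)" unfolding P_def[abs_def] using n by (intro tendsto_Pair) (auto simp: zero_power)
  moreover have "P k \<noteq> 0" for k using t_pos[of k] s by (simp add: P_def zero_prod_def)
  ultimately have P0: "filterlim P (at 0) sequentially" by (simp add: filterlim_at zero_prod_def)
  have gP: "\<forall>\<^sub>F k in sequentially. pair_eval g (P k) \<noteq> 0"
    using iso P0 by (rule eventually_compose_filterlim)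
  have "filterlim P (at 0 within {P. pair_eval g P \<noteq> 0}) sequentially"
    using P0 gP unfolding filterlim_at by (auto elim: eventually_elim2)
  with lim have "(\<lambda>k. pair_eval f (P k) / pair_eval g (P k)) \<longlonglongrightarrow> 0" by (rule filterlim_compose)
  then have "(\<lambda>k. complex_of_real (pair_eval f (P k) / pair_eval g (P k))) \<longlonglongrightarrow> of_real 0" by (rule tendsto_of_real)
  moreover have "\<forall>\<^sub>F k in sequentially. complex_of_real (pair_eval f (P k) / pair_eval g (P k)) = \<Phi> f (T k) / \<Phi> g (T k)"
    using \<Phi>P[of f] \<Phi>P[of g] by eventually_elim simp
  ultimately have ratio: "(\<lambda>k. \<Phi> f (T k) / \<Phi> g (T k)) \<longlonglongrightarrow> 0"
    using Lim_transform_eventually by fastforce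
  have "\<forall>\<^sub>F k in sequentially. \<Phi> g (T k) \<noteq> 0"
    using gP \<Phi>P[of g] by eventually_elim simp
  then have gT: "finite {k. \<Phi> g (T k) = 0}" by (simp add: eventually_cofinite flip: cofinite_eq_sequentially)
  then have "infinite (UNIV - {k. \<Phi> g (T k) = 0})" by (intro Diff_infinite_finite) auto
  then have "infinite {k. \<Phi> g (T k) \<noteq> 0}" by (simp add: set_diff_eq)
  then have Sg: "S g \<noteq> 0" by (rule fps_nonzero_if_values_nonzero[OF \<Phi> T])
  have Sf: "S f \<noteq> 0" using f by (simp add: S_def)
  have "\<not> subdegree (S f) \<le> subdegree (S g)"
  proof
    assume "subdegree (S f) \<le> subdegree (S g)"
    then obtain l where "((\<lambda>z. \<Phi> g z / \<Phi> f z) \<longlongrightarrow> l) (at 0)"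
      by (rule fps_ratio_tendsto[OF \<Phi> Sg \<Phi> Sf]) blast
    then have "(\<lambda>k. \<Phi> g (T k) / \<Phi> f (T k)) \<longlonglongrightarrow> l" using T by (rule filterlim_compose)
    then have "(\<lambda>k. (\<Phi> f (T k) / \<Phi> g (T k)) * (\<Phi> g (T k) / \<Phi> f (T k))) \<longlonglongrightarrow> 0 * l"
      by (intro tendsto_mult ratio)
    moreover have "finite {k. \<Phi> f (T k) = 0}"
      using fps_eq_0_if_zeros_accumulate[OF \<Phi> T] Sf by blast
    then have "\<forall>\<^sub>F k in sequentially. \<Phi> f (T k) \<noteq> 0"
      by (simp add: eventually_cofinite flip: cofinite_eq_sequentially)
    with \<open>\<forall>\<^sub>F k in sequentially. \<Phi> g (T k) \<noteq> 0\<close>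
    have "\<forall>\<^sub>F k in sequentially. (\<Phi> f (T k) / \<Phi> g (T k)) * (\<Phi> g (T k) / \<Phi> f (T k)) = 1"
      by eventually_elim simp
    ultimately have "(\<lambda>k. 1 :: complex) \<longlonglongrightarrow> 0 * l" by (rule Lim_transform_eventually)
    then show False by (simp add: tendsto_const_iff)
  qed
  then show ?thesis
    using Sf Sg n by (simp add: ord_subst_def S_def \<gamma>_eq divide_strict_right_mono)
qed

text \<open>Along the branch of F through infinitely many critical points, the order condition
  drives f/g to 0, while at those points |f/g| >= \<epsilon>.\<close>

lemma ratio_tendsto_0_if_ord_subst_less:
  assumes g0: "pair_eval g 0 = 0" and iso: "\<forall>\<^sub>F P in at 0. pair_eval g P \<noteq> 0"
    and reg: "y_regular (jacobian2 f g)"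
    and ord: "\<And>s \<gamma>. s \<in> {1, -1} \<Longrightarrow>
      \<gamma> \<in> real_newton_puiseux_roots s (jacobian2 f g) - real_newton_puiseux_roots s f \<Longrightarrow>
      ord_subst (scale_x s f) \<gamma> > ord_subst (scale_x s g) \<gamma>"
  shows "((\<lambda>P. pair_eval f P / pair_eval g P) \<longlongrightarrow> 0) (at 0 within {P. pair_eval g P \<noteq> 0})"
proof (rule ccontr)
  define F where "F = jacobian2 f g"
  assume "\<not> ?thesis"
  from critical_sequence_if_not_tendsto[OF g0 iso this]
  obtain \<epsilon> Q where \<epsilon>: "\<epsilon> > 0" and Q: "Q \<longlonglongrightarrow> 0" "\<And>k. pair_eval g (Q k) \<noteq> 0" "\<And>k. pair_eval F (Q k) = 0"
    "\<And>k. \<epsilon> * \<bar>pair_eval g (Q k)\<bar> \<le> \<bar>pair_eval f (Q k)\<bar>"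
    unfolding F_def by blast
  obtain r C where r: "r > 0" and C: "\<And>a b. \<bar>b\<bar> < r \<Longrightarrow> poly2 F a b = 0 \<Longrightarrow> \<bar>b\<bar> \<le> C * \<bar>a\<bar>"
    using y_regular_zero_bound[OF reg] unfolding F_def by metis
  have Q_fst: "(\<lambda>k. fst (Q k)) \<longlonglongrightarrow> 0" and Q_snd: "(\<lambda>k. snd (Q k)) \<longlonglongrightarrow> 0"
    using tendsto_fst[OF Q(1)] tendsto_snd[OF Q(1)] by simp_all
  have "\<forall>\<^sub>F k in sequentially. \<bar>snd (Q k)\<bar> < r"
    using tendstoD[OF Q_snd r] by (simp add: dist_real_def)
  then have fin: "finite {k. \<not> \<bar>snd (Q k)\<bar> < r}"
    by (simp add: eventually_cofinite flip: cofinite_eq_sequentially)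
  \<comment> \<open>On the y-axis the linear bound leaves only the origin, where g vanishes, whereas
    g is nonzero at every \<open>Q k\<close>.\<close>
  have bound: "fst (Q k) \<noteq> 0 \<and> \<bar>snd (Q k)\<bar> \<le> C * \<bar>fst (Q k)\<bar>" if "\<bar>snd (Q k)\<bar> < r" for k
  proof -
    have le: "\<bar>snd (Q k)\<bar> \<le> C * \<bar>fst (Q k)\<bar>"
      using C[OF that] Q(3)[of k] by (simp add: pair_eval_def)
    moreover have "fst (Q k) \<noteq> 0"
    proof
      assume "fst (Q k) = 0"
      with le have "Q k = 0" by (simp add: prod_eq_iff)
      then show False using Q(2)[of k] g0 by simp
    qed
    ultimately show ?thesis by blast
  qed
  have "\<exists>s\<in>{1, -1}. infinite {k. s * fst (Q k) > 0 \<and> \<bar>snd (Q k)\<bar> < r}"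
  proof (rule ccontr)
    assume "\<not> ?thesis"
    then have "finite ({k. fst (Q k) > 0 \<and> \<bar>snd (Q k)\<bar> < r} \<union> {k. fst (Q k) < 0 \<and> \<bar>snd (Q k)\<bar> < r} \<union> {k. \<not> \<bar>snd (Q k)\<bar> < r})"
      using fin by simp
    moreover have "UNIV \<subseteq> {k. fst (Q k) > 0 \<and> \<bar>snd (Q k)\<bar> < r} \<union> {k. fst (Q k) < 0 \<and> \<bar>snd (Q k)\<bar> < r} \<union> {k. \<not> \<bar>snd (Q k)\<bar> < r}"
      using bound by (auto simp: neq_iff)
    ultimately show False using infinite_UNIV_nat finite_subset by blast
  qed
  then obtain s :: real where s: "s \<in> {1, -1}" and inf: "infinite {k. s * fst (Q k) > 0 \<and> \<bar>snd (Q k)\<bar> < r}"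
    by blast
  obtain \<sigma> :: "nat \<Rightarrow> nat" where \<sigma>: "strict_mono \<sigma>" "\<And>k. s * fst (Q (\<sigma> k)) > 0 \<and> \<bar>snd (Q (\<sigma> k))\<bar> < r"
    using infinite_enumerate[OF inf] by auto
  \<comment> \<open>As s is its own inverse, fst (Q) = s x with x > 0; this turns both half planes
    into zeros of F(s x, y) with x > 0.\<close>
  have ss: "s * s = 1" and s0: "s \<noteq> 0" using s by auto
  define x where "x k = s * fst (Q (\<sigma> k))" for k
  define y where "y k = snd (Q (\<sigma> k))" for k
  have Q_eq: "pair_eval h (Q (\<sigma> k)) = poly2 h (s * x k) (y k)" for h k
    using ss by (simp add: pair_eval_def x_def y_def flip: mult.assoc)
  have x_pos: "x k > 0" for k using \<sigma>(2) by (simp add: x_def)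
  have "(\<lambda>k. s * fst (Q (\<sigma> k))) \<longlonglongrightarrow> s * 0"
    using LIMSEQ_subseq_LIMSEQ[OF Q_fst \<sigma>(1)] by (intro tendsto_intros) (simp add: o_def)
  then have x0: "x \<longlonglongrightarrow> 0" by (simp add: x_def[abs_def])
  have y_le: "\<bar>y k\<bar> \<le> C * x k" for k
  proof -
    have "\<bar>fst (Q (\<sigma> k))\<bar> = x k" using x_pos[of k] s by (auto simp: x_def)
    then show ?thesis using bound[of "\<sigma> k"] \<sigma>(2) by (simp add: y_def)
  qed
  have "F \<noteq> 0" using reg by (simp add: F_def y_regular_def)
  then have "scale_x s F \<noteq> 0" using s0 by (rule scale_x_nonzero)
  moreover have "poly2 (scale_x s F) (x k) (y k) = 0" for k
    using Q(3)[of "\<sigma> k"] by (simp add: poly2_scale_x Q_eq)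
  ultimately obtain n q where root: "(n, q) \<in> newton_puiseux_roots (scale_x s F)" and real: "real_puiseux (n, q)"
    and T: "filterlim (\<lambda>k. complex_of_real (root n (x k))) (at 0) sequentially"
    and qy: "infinite {k. eval_fps q (of_real (root n (x k))) = complex_of_real (y k)}"
    by (rule real_puiseux_root_through_sequence[OF _ _ x_pos x0 y_le]) blast
  define \<gamma> where "\<gamma> = (n, q)"
  have n: "n > 0" and q: "fps_conv_radius q > 0"
    using root by (auto simp: newton_puiseux_roots_def puiseux_series_def)
  define \<Phi> where "\<Phi> h t = eval2 (complexify (scale_x s h)) (t ^ n) (eval_fps q t)" for h t
  define S where "S h = puiseux_subst (scale_x s h) \<gamma>" for h
  have \<Phi>: "\<Phi> h has_fps_expansion S h" for h
    unfolding \<Phi>_def S_def \<gamma>_def by (rule puiseux_subst_has_fps_expansion[OF q])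
  define t where "t k = complex_of_real (root n (x k))" for k
  define K where "K = {k. eval_fps q (t k) = complex_of_real (y k)}"
  have K: "infinite K" using qy by (simp add: K_def t_def)
  have \<Phi>t: "\<Phi> h (t k) = of_real (pair_eval h (Q (\<sigma> k)))" if "k \<in> K" for h k
  proof -
    have "root n (x k) ^ n = x k" using n x_pos[of k] by (simp add: real_root_pow_pos2 less_imp_le)
    then show ?thesis
      using eval2_complexify_scale_x[of q "root n (x k)" "y k" s h] that
      by (simp add: \<Phi>_def K_def t_def Q_eq)
  qed
  have f_nz: "pair_eval f (Q k) \<noteq> 0" for k
  proof -
    have "0 < \<epsilon> * \<bar>pair_eval g (Q k)\<bar>" using Q(2)[of k] \<epsilon> by simp
    also note Q(4)[of k]
    finally show ?thesis by simp
  qed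
  have S_nz: "S h \<noteq> 0" if "\<And>k. pair_eval h (Q k) \<noteq> 0" for h
  proof (rule fps_nonzero_if_values_nonzero[OF \<Phi> T])
    have "K \<subseteq> {k. \<Phi> h (t k) \<noteq> 0}" using \<Phi>t that by auto
    then show "infinite {k. \<Phi> h (complex_of_real (root n (x k))) \<noteq> 0}"
      using K finite_subset unfolding t_def by blast
  qed
  \<comment> \<open>Nonvanishing of f at the points shows that the branch is not a root of f, so the
    order condition applies to it.\<close>
  have Sf: "S f \<noteq> 0" and Sg: "S g \<noteq> 0" using S_nz f_nz Q(2) by blast+
  have "\<gamma> \<in> real_newton_puiseux_roots s F - real_newton_puiseux_roots s f"
    using root real Sf by (simp add: real_newton_puiseux_roots_def \<gamma>_def S_def newton_puiseux_roots_def)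
  then have "ord_subst (scale_x s f) \<gamma> > ord_subst (scale_x s g) \<gamma>"
    using ord[OF s] by (simp add: F_def)
  then have less: "subdegree (S g) < subdegree (S f)"
    using Sf Sg n by (simp add: ord_subst_def S_def \<gamma>_def divide_less_cancel)
  obtain l where l: "((\<lambda>z. \<Phi> f z / \<Phi> g z) \<longlongrightarrow> l) (at 0)" "subdegree (S g) < subdegree (S f) \<Longrightarrow> l = 0"
    by (rule fps_ratio_tendsto[OF \<Phi> Sf \<Phi> Sg less_imp_le[OF less]]) blast
  then have "((\<lambda>z. \<Phi> f z / \<Phi> g z) \<longlongrightarrow> 0) (at 0)" using less by simp
  then have "(\<lambda>k. \<Phi> f (t k) / \<Phi> g (t k)) \<longlonglongrightarrow> 0" unfolding t_def using T by (rule filterlim_compose)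
  from tendstoD[OF this \<epsilon>] have "finite {k. \<not> norm (\<Phi> f (t k) / \<Phi> g (t k)) < \<epsilon>}"
    by (simp add: eventually_cofinite flip: cofinite_eq_sequentially)
  moreover have "K \<subseteq> {k. \<not> norm (\<Phi> f (t k) / \<Phi> g (t k)) < \<epsilon>}"
  proof
    fix k assume "k \<in> K"
    then have "norm (\<Phi> f (t k) / \<Phi> g (t k)) = \<bar>pair_eval f (Q (\<sigma> k))\<bar> / \<bar>pair_eval g (Q (\<sigma> k))\<bar>"
      by (simp add: \<Phi>t norm_divide)
    also have "\<dots> \<ge> \<epsilon>" using Q(2,4)[of "\<sigma> k"] by (simp add: pos_le_divide_eq)
    finally show "k \<in> {k. \<not> norm (\<Phi> f (t k) / \<Phi> g (t k)) < \<epsilon>}" by simp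
  qed
  ultimately show False using K finite_subset by blast
qed

theorem theorem4p8:
  fixes f g :: "real poly poly"
  assumes "f \<noteq> 0" and "g \<noteq> 0"
    and "poly2 f 0 0 = 0" and "poly2 g 0 0 = 0"
    and "isolated_zero_at_origin g"
    and "jacobian2 f g \<noteq> 0"
    and "y_regular f" and "y_regular g" and "y_regular (jacobian2 f g)"
  shows "((\<lambda>(x, y). poly2 f x y / poly2 g x y) \<longlongrightarrow> 0)
             (at (0, 0) within {(x, y). poly2 g x y \<noteq> 0}) \<longleftrightarrow>
         (\<forall>s\<in>{1, -1}.
            \<forall>\<gamma> \<in> real_newton_puiseux_roots s (jacobian2 f g) - real_newton_puiseux_roots s f.
              ord_subst (scale_x s f) \<gamma> > ord_subst (scale_x s g) \<gamma>)"
proof -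
  have g0: "pair_eval g 0 = 0" using assms(4) by (simp add: pair_eval_def)
  have iso: "\<forall>\<^sub>F P in at 0. pair_eval g P \<noteq> 0"
    using assms(5) by (simp add: isolated_zero_at_origin_def pair_eval_def case_prod_unfold zero_prod_def)
  have lim_eq: "((\<lambda>(x, y). poly2 f x y / poly2 g x y) \<longlongrightarrow> 0) (at (0, 0) within {(x, y). poly2 g x y \<noteq> 0}) \<longleftrightarrow>
      ((\<lambda>P. pair_eval f P / pair_eval g P) \<longlongrightarrow> 0) (at 0 within {P. pair_eval g P \<noteq> 0})"
    by (simp add: pair_eval_def case_prod_unfold zero_prod_def)
  show ?thesis
    unfolding lim_eq
  proof (intro iffI ballI)
    fix s :: real and \<gamma>
    assume lim: "((\<lambda>P. pair_eval f P / pair_eval g P) \<longlongrightarrow> 0) (at 0 within {P. pair_eval g P \<noteq> 0})"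
      and s: "s \<in> {1, -1}"
      and \<gamma>: "\<gamma> \<in> real_newton_puiseux_roots s (jacobian2 f g) - real_newton_puiseux_roots s f"
    show "ord_subst (scale_x s g) \<gamma> < ord_subst (scale_x s f) \<gamma>"
      by (rule ord_subst_less_if_ratio_tendsto_0[OF _ _ _ _ g0 iso lim])
         (use \<gamma> s in \<open>auto simp: real_newton_puiseux_roots_def newton_puiseux_roots_def\<close>)
  next
    assume "\<forall>s\<in>{1, -1}. \<forall>\<gamma>\<in>real_newton_puiseux_roots s (jacobian2 f g) - real_newton_puiseux_roots s f.
        ord_subst (scale_x s g) \<gamma> < ord_subst (scale_x s f) \<gamma>"
    then show "((\<lambda>P. pair_eval f P / pair_eval g P) \<longlongrightarrow> 0) (at 0 within {P. pair_eval g P \<noteq> 0})"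
      using ratio_tendsto_0_if_ord_subst_less[OF g0 iso assms(9)] by blast
  qed
qed

end
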